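(* Let $\mathtt{P}=(\mathtt{P_{yes}},\mathtt{P_{no}})$ be a promise problem over a unary alphabet $\{a\}$. If $\mathtt{P}$ is solvable by a Las Vegas quantum finite automaton with some success probability $p>0$, then $\mathtt{P}$ is also solvable by a deterministic finite automaton (i.e. a DFA accepting every string of $\mathtt{P_{yes}}$ and rejecting every string of $\mathtt{P_{no}}$).
   Context: A promise problem over $\Sigma$ is a pair of disjoint languages $\mathtt{P_{yes}},\mathtt{P_{no}}\subseteq\Sigma^*$. The QFA model is the Moore–Crutchfield QFA: finite state set $Q$, unitary matrices $U_\sigma$ ($\sigma\in\Sigma$), unit-norm complex initial vector $|v_0\rangle$; on input $w=w_1\cdots w_\ell$ the final vector is $|v_\ell\rangle=U_{w_\ell}\cdots U_{w_1}|v_0\rangle$, and the probability of ending in a set $S\subseteq Q$ is $\sum_{q_j\in S}|\,|v_\ell\rangle(j)|^2$. A Las Vegas QFA has its states partitioned into accepting states $Q_a$, neutral ("don't know") states $Q_n$ and rejecting states $Q_r$. It solves $\mathtt{P}$ with success probability $p>0$ if every yes-instance is accepted with probability at least $p$ and rejected with probability $0$, and every no-instance is rejected with probability at least $p$ and accepted with probability $0$. *)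

theory Defs
  imports "Jordan_Normal_Form.Schur_Decomposition"
begin

type_synonym 'a promise = "'a list set \<times> 'a list set"

definition promise_problem :: "'a set \<Rightarrow> 'a promise \<Rightarrow> bool" where
  "promise_problem \<Sigma> P \<longleftrightarrow> fst P \<subseteq> lists \<Sigma> \<and> snd P \<subseteq> lists \<Sigma> \<and> fst P \<inter> snd P = {}"

definition unitary_mat :: "nat \<Rightarrow> complex mat \<Rightarrow> bool" where
  "unitary_mat n U \<longleftrightarrow>
     U \<in> carrier_mat n n \<and> U * mat_adjoint U = 1\<^sub>m n \<and> mat_adjoint U * U = 1\<^sub>m n"

text \<open>The states of a quantum automaton are numbered from 0, so that they index the entries of
  its state vectors: the state set of \<open>M\<close> is \<open>{..<qstates M}\<close>.\<close>

record 'a qfa =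
  qstates :: nat
  qtrans :: "'a \<Rightarrow> complex mat"
  qinit :: "complex vec"

definition mc_qfa :: "'a set \<Rightarrow> ('a, 'b) qfa_scheme \<Rightarrow> bool" where
  "mc_qfa \<Sigma> M \<longleftrightarrow>
     (\<forall>\<sigma>\<in>\<Sigma>. unitary_mat (qstates M) (qtrans M \<sigma>)) \<and>
     qinit M \<in> carrier_vec (qstates M) \<and>
     (\<Sum>j<qstates M. (cmod (qinit M $ j))\<^sup>2) = 1"

definition final_vec :: "('a, 'b) qfa_scheme \<Rightarrow> 'a list \<Rightarrow> complex vec" where
  "final_vec M w = fold (\<lambda>\<sigma> v. qtrans M \<sigma> *\<^sub>v v) w (qinit M)"

definition prob_in :: "('a, 'b) qfa_scheme \<Rightarrow> nat set \<Rightarrow> 'a list \<Rightarrow> real" where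
  "prob_in M S w = (\<Sum>j\<in>S. (cmod (final_vec M w $ j))\<^sup>2)"

record 'a lv_qfa = "'a qfa" +
  accepting :: "nat set"
  neutral :: "nat set"
  rejecting :: "nat set"

text \<open>Each of the three blocks of the partition may be empty.\<close>

definition las_vegas_qfa :: "'a set \<Rightarrow> 'a lv_qfa \<Rightarrow> bool" where
  "las_vegas_qfa \<Sigma> M \<longleftrightarrow>
     mc_qfa \<Sigma> M \<and>
     accepting M \<union> neutral M \<union> rejecting M = {..<qstates M} \<and>
     accepting M \<inter> neutral M = {} \<and>
     accepting M \<inter> rejecting M = {} \<and>
     neutral M \<inter> rejecting M = {}"

definition lv_solves :: "'a lv_qfa \<Rightarrow> 'a promise \<Rightarrow> real \<Rightarrow> bool" where
  "lv_solves M P p \<longleftrightarrow>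
     (\<forall>w\<in>fst P. prob_in M (accepting M) w \<ge> p \<and> prob_in M (rejecting M) w = 0) \<and>
     (\<forall>w\<in>snd P. prob_in M (rejecting M) w \<ge> p \<and> prob_in M (accepting M) w = 0)"

record ('s, 'a) dfa =
  dstates :: "'s set"
  dtrans :: "'s \<Rightarrow> 'a \<Rightarrow> 's"
  dinit :: 's
  dfinal :: "'s set"

definition is_dfa :: "'a set \<Rightarrow> ('s, 'a) dfa \<Rightarrow> bool" where
  "is_dfa \<Sigma> D \<longleftrightarrow>
     finite (dstates D) \<and> dinit D \<in> dstates D \<and> dfinal D \<subseteq> dstates D \<and>
     (\<forall>q\<in>dstates D. \<forall>\<sigma>\<in>\<Sigma>. dtrans D q \<sigma> \<in> dstates D)"

definition dfa_accepts :: "('s, 'a) dfa \<Rightarrow> 'a list \<Rightarrow> bool" where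
  "dfa_accepts D w \<longleftrightarrow> fold (\<lambda>\<sigma> q. dtrans D q \<sigma>) w (dinit D) \<in> dfinal D"

definition dfa_solves :: "('s, 'a) dfa \<Rightarrow> 'a promise \<Rightarrow> bool" where
  "dfa_solves D P \<longleftrightarrow> (\<forall>w\<in>fst P. dfa_accepts D w) \<and> (\<forall>w\<in>snd P. \<not> dfa_accepts D w)"

end

theory Submission
  imports Defs
begin

text \<open>The rejection amplitudes of the word \<open>a\<^sup>k\<close> are entries of \<open>U\<^sup>k v\<^sub>0\<close>, and a word is a
  possible yes-instance only if all of them vanish, while a no-instance has a nonvanishing one. It
  therefore suffices that the set of zeros of each amplitude is eventually periodic, which is the
  Skolem--Mahler--Lech theorem. For its proof the entries of \<open>U\<close>, \<open>U\<^sup>*\<close> and \<open>v\<^sub>0\<close> are placed in a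
  subring \<open>W\<close> of the complex numbers that has no nonzero elements divisible by all powers of an odd
  prime \<open>p\<close> and in which they generate only finitely many residues modulo \<open>p\<close>. By the pigeonhole
  principle some power \<open>U\<^sup>m\<close> is \<open>1 + p C\<close> with \<open>C\<close> over \<open>W\<close>, so along every residue class modulo \<open>m\<close>
  an amplitude has a Newton expansion \<open>\<Sum>\<^sub>k (n choose k) p\<^sup>k b\<^sub>k\<close>. As \<open>p\<^sup>k / k!\<close> tends to zero
  \<open>p\<close>-adically, such an expansion with infinitely many zeros vanishes identically.\<close>

section \<open>Newton series with infinitely many zeros\<close>

definition is_subring :: "'a::comm_ring_1 set \<Rightarrow> bool" where
  "is_subring W \<longleftrightarrow> 1 \<in> W \<and> (\<forall>x\<in>W. \<forall>y\<in>W. x - y \<in> W \<and> x * y \<in> W)"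

text \<open>The rings of a model sit inside one another within a single type, so W[X] is cut out of
  the polynomials over the ambient ring instead of being a type of its own.\<close>

definition polys_over :: "'a::comm_ring_1 set \<Rightarrow> 'a poly set" where
  "polys_over W = {f. \<forall>i. coeff f i \<in> W}"

lemma subring_1: "is_subring W \<Longrightarrow> 1 \<in> W"
  and subring_diff: "is_subring W \<Longrightarrow> x \<in> W \<Longrightarrow> y \<in> W \<Longrightarrow> x - y \<in> W"
  and subring_mult: "is_subring W \<Longrightarrow> x \<in> W \<Longrightarrow> y \<in> W \<Longrightarrow> x * y \<in> W"
  by (auto simp: is_subring_def)

lemma subring_0: "is_subring W \<Longrightarrow> 0 \<in> W"
  using subring_diff[OF _ subring_1 subring_1, of W] by auto

lemma subring_uminus: "is_subring W \<Longrightarrow> x \<in> W \<Longrightarrow> - x \<in> W"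
  using subring_diff[OF _ subring_0, of W x] by auto

lemma subring_add: "is_subring W \<Longrightarrow> x \<in> W \<Longrightarrow> y \<in> W \<Longrightarrow> x + y \<in> W"
  using subring_diff[OF _ _ subring_uminus, of W x y] by auto

lemma subring_sum: "is_subring W \<Longrightarrow> (\<And>i. i \<in> I \<Longrightarrow> f i \<in> W) \<Longrightarrow> sum f I \<in> W"
  by (induction I rule: infinite_finite_induct) (auto simp: subring_0 subring_add)

lemma subring_of_nat: "is_subring W \<Longrightarrow> of_nat n \<in> W"
  by (induction n) (auto simp: subring_0 subring_1 subring_add)

lemma subring_of_int: "is_subring W \<Longrightarrow> of_int n \<in> W"
  by (cases n rule: int_cases2) (auto simp: subring_of_nat subring_uminus)

lemma subring_power: "is_subring W \<Longrightarrow> x \<in> W \<Longrightarrow> x ^ n \<in> W"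
  by (induction n) (auto simp: subring_1 subring_mult)

lemma subring_prod: "is_subring W \<Longrightarrow> (\<And>i. i \<in> I \<Longrightarrow> f i \<in> W) \<Longrightarrow> prod f I \<in> W"
  by (induction I rule: infinite_finite_induct) (auto simp: subring_1 subring_mult)

lemmas subring_intros =
  subring_0 subring_1 subring_add subring_diff subring_uminus subring_mult subring_sum
  subring_of_nat subring_of_int subring_power

lemma coeff_polys_over: "f \<in> polys_over W \<Longrightarrow> coeff f i \<in> W"
  by (auto simp: polys_over_def)

lemma pCons_polys_over: "pCons c f \<in> polys_over W \<longleftrightarrow> c \<in> W \<and> f \<in> polys_over W"
  by (auto simp: polys_over_def coeff_pCons split: nat.splits)

lemma zero_polys_over: "is_subring W \<Longrightarrow> 0 \<in> polys_over W"
  by (auto simp: polys_over_def subring_0)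

lemma subring_polys_over:
  assumes "is_subring W"
  shows "is_subring (polys_over W)"
  unfolding is_subring_def
proof (intro conjI ballI)
  show "1 \<in> polys_over W"
    using assms by (auto simp: one_pCons pCons_polys_over subring_1 zero_polys_over)
  fix f g assume "f \<in> polys_over W" "g \<in> polys_over W"
  then show "f - g \<in> polys_over W" "f * g \<in> polys_over W"
    using assms by (auto simp: polys_over_def coeff_mult intro!: subring_intros)
qed

lemma polys_over_mono: "W \<subseteq> K \<Longrightarrow> polys_over W \<subseteq> polys_over K"
  by (auto simp: polys_over_def)

lemma smult_polys_over: "is_subring W \<Longrightarrow> c \<in> W \<Longrightarrow> f \<in> polys_over W \<Longrightarrow> smult c f \<in> polys_over W"
  by (auto simp: polys_over_def subring_mult)

lemma monom_polys_over: "is_subring W \<Longrightarrow> c \<in> W \<Longrightarrow> monom c n \<in> polys_over W"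
  by (auto simp: polys_over_def subring_0)

lemma pcompose_polys_over:
  assumes "is_subring W" "f \<in> polys_over W" "g \<in> polys_over W"
  shows "pcompose f g \<in> polys_over W"
  using assms(2)
proof (induction f)
  case 0
  then show ?case using assms by (simp add: zero_polys_over)
next
  case (pCons c f)
  note R = subring_polys_over[OF assms(1)]
  have "[:c:] \<in> polys_over W"
    using pCons.prems assms by (auto simp: pCons_polys_over zero_polys_over)
  then show ?case
    using pCons assms R by (auto simp: pcompose_pCons pCons_polys_over intro!: subring_intros)
qed

lemma poly_in_subring:
  assumes "is_subring W" "f \<in> polys_over W" "x \<in> W"
  shows "poly f x \<in> W"
  using assms(2)
  by (induction f) (auto simp: pCons_polys_over assms intro!: subring_intros)

text \<open>Cancelling the top coefficient against a monic divisor needs no inverses, so division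
  works over any subring. The remainder is bounded by vanishing coefficients rather than by its
  degree; a zero remainder and a constant divisor then need no separate case.\<close>

lemma monic_division:
  assumes W: "is_subring W" and f: "f \<in> polys_over W" "lead_coeff f = 1"
    and g: "g \<in> polys_over W"
  shows "\<exists>q\<in>polys_over W. \<exists>r\<in>polys_over W. g = f * q + r \<and> (\<forall>i\<ge>degree f. coeff r i = 0)"
proof -
  note R = subring_polys_over[OF W]
  have "\<exists>q\<in>polys_over W. \<exists>r\<in>polys_over W. g = f * q + r \<and> (\<forall>i\<ge>degree f. coeff r i = 0)"
    if "\<forall>i\<ge>n. coeff g i = 0" "g \<in> polys_over W" for n g
    using that
  proof (induction n arbitrary: g)
    case 0
    then have "g = 0" by (auto intro: poly_eqI)
    then show ?case
      using subring_0[OF R] by (intro bexI[of _ 0]) auto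
  next
    case (Suc n)
    show ?case
    proof (cases "Suc n \<le> degree f")
      case True
      then show ?thesis
        using Suc subring_0[OF R] by (intro bexI[of _ 0] bexI[of _ g]) auto
    next
      case False
      define h where "h = monom (coeff g n) (n - degree f)"
      have h: "h \<in> polys_over W"
        unfolding h_def using Suc.prems W by (intro monom_polys_over) (auto simp: coeff_polys_over)
      have "coeff (g - f * h) i = 0" if "i \<ge> n" for i
      proof (cases "i = n")
        case True
        then show ?thesis
          using False f(2) by (simp add: h_def mult.commute[of f] coeff_monom_mult)
      next
        case False
        then have "i \<ge> Suc n" "i - (n - degree f) > degree f"
          using that \<open>\<not> Suc n \<le> degree f\<close> by auto
        then show ?thesis
          using Suc.prems(1) by (simp add: h_def mult.commute[of f] coeff_monom_mult coeff_eq_0)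
      qed
      moreover have "g - f * h \<in> polys_over W"
        using R h f Suc.prems by (intro subring_intros)
      ultimately obtain q r where qr: "q \<in> polys_over W" "r \<in> polys_over W"
        "g - f * h = f * q + r" "\<forall>i\<ge>degree f. coeff r i = 0"
        using Suc.IH by blast
      then show ?thesis
        using subring_add[OF R qr(1) h] by (intro bexI[of _ "q + h"] bexI[of _ r]) (auto simp: algebra_simps)
    qed
  qed
  moreover have "\<forall>i\<ge>Suc (degree g). coeff g i = 0" by (simp add: coeff_eq_0)
  ultimately show ?thesis using g by blast
qed

text \<open>In the factorial of \<open>p * q + s\<close> with \<open>s < p\<close>, the multiples of
  \<open>p\<close> contribute \<open>p ^ q * fact q\<close>, so the exponent of \<open>p\<close> is
  \<open>q\<close> plus that of \<open>fact q\<close>. By induction twice this is at most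
  \<open>3 * q\<close>, hence at most \<open>p * q\<close> as \<open>p\<close> is at least 3. Up to
  a factor prime to \<open>p\<close>, the quotient \<open>p ^ k / fact k\<close> is therefore
  divisible by \<open>p\<close> at least k/2 times.\<close>

lemma fact_prime_part:
  assumes "prime p" "p > (2::nat)"
  shows "\<exists>e u. fact k = p ^ e * u \<and> coprime u p \<and> 2 * e \<le> k"
proof (induction k rule: less_induct)
  case (less k)
  have step: "\<exists>u. fact (p * q + s) = p ^ q * fact q * u \<and> coprime u p" if s: "s < p" for q s
  proof -
    have aux: "\<exists>u. fact (p * q + s) = fact (p * q) * u \<and> coprime u p" if "s < p" for q s
      using that
    proof (induction s)
      case (Suc s)
      then obtain u where u: "fact (p * q + s) = fact (p * q) * u" "coprime u p" by auto
      have "\<not> p dvd (p * q + Suc s)"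
        using Suc.prems by (metis dvd_add_right_iff dvd_triv_left nat_dvd_not_less zero_less_Suc)
      then have "coprime (p * q + Suc s) p"
        using assms(1) prime_imp_coprime coprime_commute by blast
      moreover have "fact (p * q + Suc s) = fact (p * q) * (u * (p * q + Suc s))"
        using u(1) by (simp add: algebra_simps)
      ultimately show ?case
        using u(2) by (intro exI[of _ "u * (p * q + Suc s)"]) (simp only: coprime_mult_left_iff simp_thms)
    qed auto
    have "\<exists>u. fact (p * q) = p ^ q * fact q * u \<and> coprime u p"
    proof (induction q)
      case (Suc q)
      then obtain u where u: "fact (p * q) = p ^ q * fact q * u" "coprime u p" by auto
      obtain v where v: "fact (p * q + (p - 1)) = fact (p * q) * v" "coprime v p"
        using aux[of "p - 1" q] assms by auto
      have "p * Suc q = Suc (p * q + (p - 1))" using assms by simp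
      then have "fact (p * Suc q) = (p * Suc q) * fact (p * q + (p - 1))"
        by (metis fact_Suc of_nat_id)
      also have "\<dots> = p ^ Suc q * fact (Suc q) * (u * v)"
        using u v by (simp add: algebra_simps)
      finally show ?case using u v by (intro exI[of _ "u * v"]) auto
    qed (auto intro: exI[of _ 1])
    then obtain u where "fact (p * q) = p ^ q * fact q * u" "coprime u p" by auto
    moreover obtain v where "fact (p * q + s) = fact (p * q) * v" "coprime v p"
      using aux[OF s] by auto
    ultimately show ?thesis
      by (intro exI[of _ "u * v"]) auto
  qed
  show ?case
  proof (cases "k = 0")
    case True
    then show ?thesis by (intro exI[of _ 0] exI[of _ 1]) auto
  next
    case False
    define q where "q = k div p"
    have "q < k" using False assms by (auto simp: q_def)
    from less[OF this] obtain e u where eu: "fact q = p ^ e * u" "coprime u p" "2 * e \<le> q"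
      by auto
    obtain v where v: "fact (p * q + k mod p) = p ^ q * fact q * v" "coprime v p"
      using step[of "k mod p" q] assms by auto
    have k: "p * q + k mod p = k" by (simp add: q_def)
    have "3 * q \<le> p * q" using assms by simp
    also have "p * q \<le> k" using k by (metis le_add1)
    finally have "2 * (q + e) \<le> k" using eu(3) by simp
    moreover have "fact k = p ^ (q + e) * (u * v)"
      using v eu k by (simp add: power_add algebra_simps)
    ultimately show ?thesis
      using eu v by (intro exI[of _ "q + e"] exI[of _ "u * v"]) auto
  qed
qed

text \<open>The \<open>p\<close>-adic topology on \<open>W\<close> is Hausdorff. This turns
  divisibility by every power of \<open>p\<close> into vanishing.\<close>

definition separated :: "nat \<Rightarrow> 'a::comm_ring_1 set \<Rightarrow> bool" where
  "separated p W \<longleftrightarrow> (\<forall>x. (\<forall>k. \<exists>w\<in>W. x = of_nat p ^ k * w) \<longrightarrow> x = 0)"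

text \<open>The falling factorial x(x-1)...(x-k+1). Unlike the binomial polynomial it has integer
  coefficients, so it can be divided by monic integer polynomials without denominators.\<close>

definition falling :: "nat \<Rightarrow> complex poly" where
  "falling k = (\<Prod>i<k. [:- of_nat i, 1:])"

lemma falling_Ints: "falling k \<in> polys_over \<int>"
proof -
  have Z: "is_subring (\<int> :: complex set)" by (auto simp: is_subring_def)
  show ?thesis
    unfolding falling_def using Z
    by (intro subring_prod subring_polys_over) (auto simp: pCons_polys_over zero_polys_over)
qed

lemma poly_falling: "poly (falling k) (of_nat n) = fact k * of_nat (n choose k)"
  by (simp add: falling_def poly_prod binomial_gbinomial gbinomial_mult_fact atLeast0LessThan)
    
lemma degree_falling: "degree (falling k) = k"
  unfolding falling_def by (subst degree_prod_eq_sum_degree) auto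

text \<open>Zeros force divisibility. On \<open>insert n T\<close> the series agrees with the
  polynomial that sums the \<open>c k\<close> times \<open>falling k\<close>. Dividing each
  \<open>falling k\<close> by the monic \<open>P\<close> with root set \<open>T\<close> leaves
  remainders whose combination \<open>S\<close> vanishes on \<open>T\<close> and has degree below
  \<open>card T\<close>, so it is zero. The value at \<open>n\<close> is then the value of
  \<open>P\<close> times a combination of the \<open>c k\<close> with \<open>k \<ge> card T\<close>,
  and these are divisible by \<open>p ^ j\<close> up to denominators prime to
  \<open>p\<close>.\<close>

lemma newton_series_in_power:
  fixes b :: "nat \<Rightarrow> complex"
  assumes W: "is_subring W" and p: "prime p" "p > 2" and b: "\<And>k. b k \<in> W"
    and T: "finite T" "2 * j \<le> card T"
    and zero: "\<And>t. t \<in> T \<Longrightarrow> (\<Sum>k\<le>t. of_nat (t choose k) * (of_nat p ^ k * b k)) = 0"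
  shows "\<exists>w\<in>W. (\<Sum>k\<le>n. of_nat (n choose k) * (of_nat p ^ k * b k)) = of_nat p ^ j * w"
proof -
  define F where "F = (\<lambda>n. \<Sum>k\<le>n. of_nat (n choose k) * (of_nat p ^ k * b k))"
  \<comment> \<open>\<open>M\<close> gives one summation range for all points of
    \<open>insert n T\<close>, since \<open>t choose k\<close> vanishes for
    \<open>k > t\<close>.\<close>
  define M where "M = Max (insert n T)"
  define P :: "complex poly" where "P = (\<Prod>t\<in>T. [:- of_nat t, 1:])"
  define c where "c = (\<lambda>k. of_nat p ^ k * b k / fact k)"
  have Z: "is_subring (\<int> :: complex set)" by (auto simp: is_subring_def)
  have "P \<in> polys_over \<int>"
    unfolding P_def using Z
    by (intro subring_prod subring_polys_over) (auto simp: pCons_polys_over zero_polys_over)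
  moreover have "lead_coeff P = 1"
    unfolding P_def by (simp add: lead_coeff_prod)
  moreover have degP: "degree P = card T"
    unfolding P_def by (subst degree_prod_eq_sum_degree) auto
  ultimately have "\<exists>Q R. Q \<in> polys_over \<int> \<and> R \<in> polys_over \<int> \<and> falling k = P * Q + R
     \<and> (\<forall>i\<ge>card T. coeff R i = 0)" for k
    using monic_division[OF Z _ _ falling_Ints] by metis
  then obtain Q R where QR: "\<And>k. Q k \<in> polys_over \<int>" "\<And>k. falling k = P * Q k + R k"
     "\<And>k i. i \<ge> card T \<Longrightarrow> coeff (R k) i = 0"
    by metis
  \<comment> \<open>Below degree \<open>card T\<close> the polynomial \<open>falling k\<close> is
    its own remainder. This removes exactly the terms whose \<open>c k\<close> need not be divisible
    by \<open>p ^ j\<close>.\<close>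
  have Q0: "Q k = 0" if "k < card T" for k
  proof (rule ccontr)
    assume nz: "Q k \<noteq> 0"
    moreover have "P \<noteq> 0" using \<open>lead_coeff P = 1\<close> by auto
    ultimately have "degree (P * Q k) \<ge> card T" using degP by (simp add: degree_mult_eq)
    moreover have "P * Q k = falling k - R k" using QR(2)[of k] by simp
    then have "coeff (P * Q k) i = 0" if "i \<ge> card T" for i
      using that QR(3) \<open>k < card T\<close> degree_falling[of k] by (simp add: coeff_eq_0)
    then have "lead_coeff (P * Q k) = 0" using calculation by blast
    then show False using nz \<open>P \<noteq> 0\<close> by simp
  qed
  have F: "F t = (\<Sum>k\<le>M. c k * poly (falling k) (of_nat t))" if "t \<in> insert n T" for t
  proof -
    have "t \<le> M" unfolding M_def using that T by (intro Max_ge) auto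
    then have "F t = (\<Sum>k\<le>M. of_nat (t choose k) * (of_nat p ^ k * b k))"
      unfolding F_def by (intro sum.mono_neutral_left) auto
    then show ?thesis by (simp add: poly_falling c_def mult_ac)
  qed
  define S where "S = (\<Sum>k\<le>M. smult (c k) (R k))"
  have "S = 0"
  proof (rule ccontr)
    assume S: "S \<noteq> 0"
    have "poly S (of_nat t) = 0" if "t \<in> T" for t
    proof -
      have "poly P (of_nat t) = 0" using that T by (auto simp: P_def poly_prod)
      then have "poly (falling k) (of_nat t) = poly (R k) (of_nat t)" for k
        by (subst QR(2)) simp
      then have "poly S (of_nat t) = F t" using F[of t] that by (simp add: S_def poly_sum)
      then show ?thesis using zero[OF that] by (simp add: F_def)
    qed
    then have "of_nat ` T \<subseteq> {x. poly S x = 0}" by auto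
    then have "card (of_nat ` T :: complex set) \<le> degree S"
      using card_mono[OF poly_roots_finite[OF S]] card_poly_roots_bound[OF S] by (blast intro: le_trans)
    then have "card T \<le> degree S" by (simp add: card_image inj_on_def)
    moreover have "coeff S i = 0" if "i \<ge> card T" for i
      using that QR(3) by (simp add: S_def coeff_sum)
    ultimately show False using S leading_coeff_0_iff by blast
  qed
  \<comment> \<open>The ideal generated by \<open>p ^ j\<close> after localising \<open>W\<close> at
    \<open>p\<close>: the factor \<open>u\<close> absorbs the part of a factorial that is prime to
    \<open>p\<close>.\<close>
  define I where "I = {x. \<exists>u. coprime u p \<and> (\<exists>w\<in>W. of_nat u * x = of_nat p ^ j * w)}"
  have I_add: "x + y \<in> I" if xy: "x \<in> I" "y \<in> I" for x y
  proof -
    obtain u v w z where "coprime u p" "coprime v p" "w \<in> W" "z \<in> W"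
      "of_nat u * x = of_nat p ^ j * w" "of_nat v * y = of_nat p ^ j * z"
      using xy unfolding I_def by blast
    moreover from this have "of_nat (u * v) * (x + y) = of_nat p ^ j * (of_nat v * w + of_nat u * z)"
      by (simp add: algebra_simps)
    moreover have "of_nat v * w + of_nat u * z \<in> W"
      using W calculation by (auto intro!: subring_intros)
    ultimately show ?thesis
      unfolding I_def by (intro CollectI exI[of _ "u * v"]) auto
  qed
  have I_mult: "x * z \<in> I" if x: "x \<in> I" and z: "z \<in> W" for x z
  proof -
    obtain u w where "coprime u p" "w \<in> W" "of_nat u * x = of_nat p ^ j * w"
      using x unfolding I_def by blast
    moreover from this have "of_nat u * (x * z) = of_nat p ^ j * (w * z)"
      by (metis mult.assoc)
    moreover have "w * z \<in> W" using W z calculation by (auto intro!: subring_intros)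
    ultimately show ?thesis unfolding I_def by blast
  qed
  have c_I: "c k \<in> I" if k: "k \<ge> card T" for k
  proof -
    obtain e u where eu: "fact k = p ^ e * u" "coprime u p" "2 * e \<le> k"
      using fact_prime_part[OF p] by blast
    have "u \<noteq> 0" using eu(1) by (metis fact_nonzero mult_0_right)
    \<comment> \<open>The subtraction is exact: \<open>2 * e \<le> k\<close> and
      \<open>2 * j \<le> card T \<le> k\<close> give \<open>e + j \<le> k\<close>.\<close>
    have "k = e + (j + (k - e - j))" using eu(3) k T(2) by simp
    then have "of_nat p ^ k = of_nat p ^ e * (of_nat p ^ j * of_nat p ^ (k - e - j) :: complex)"
      by (metis power_add)
    moreover have "(fact k :: complex) = of_nat p ^ e * of_nat u"
      using eu(1) by (metis of_nat_fact of_nat_mult of_nat_power)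
    ultimately have "of_nat u * c k = of_nat p ^ j * (of_nat p ^ (k - e - j) * b k)"
      using \<open>u \<noteq> 0\<close> p by (simp add: c_def field_simps)
    moreover have "of_nat p ^ (k - e - j) * b k \<in> W"
      using W b by (auto intro!: subring_intros)
    ultimately show ?thesis
      using eu(2) unfolding I_def by blast
  qed
  have "0 \<in> I" unfolding I_def using subring_0[OF W] by (intro CollectI exI[of _ 1]) auto
  then have I_sum: "sum g X \<in> I" if "\<And>i. i \<in> X \<Longrightarrow> g i \<in> I" for g and X :: "nat set"
    using that by (induction X rule: infinite_finite_induct) (auto simp: I_add)
  have ZW: "\<int> \<subseteq> W" using subring_of_int[OF W] by (auto elim!: Ints_cases)
  have "F n = poly (\<Sum>k\<le>M. smult (c k) (falling k)) (of_nat n)"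
    using F[of n] by (simp add: poly_sum)
  also have "(\<Sum>k\<le>M. smult (c k) (falling k)) = P * (\<Sum>k\<le>M. smult (c k) (Q k)) + S"
    by (subst QR(2)) (simp add: S_def smult_add_right sum.distrib sum_distrib_left)
  also have "poly \<dots> (of_nat n) = (\<Sum>k\<le>M. c k * poly (Q k) (of_nat n)) * poly P (of_nat n)"
    using \<open>S = 0\<close> by (simp add: poly_sum)
  also have "\<dots> \<in> I"
  proof (rule I_mult[OF I_sum])
    show "poly P (of_nat n) \<in> W"
      using poly_in_subring[OF Z \<open>P \<in> polys_over \<int>\<close>] ZW by auto
    fix k
    have "poly (Q k) (of_nat n) \<in> W"
      using poly_in_subring[OF Z QR(1)] ZW by auto
    then show "c k * poly (Q k) (of_nat n) \<in> I"
      using c_I[of k] I_mult Q0[of k] \<open>0 \<in> I\<close> by (cases "k < card T") auto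
  qed
  finally obtain u w where uw: "coprime u p" "w \<in> W" "of_nat u * F n = of_nat p ^ j * w"
    unfolding I_def by blast
  \<comment> \<open>Bezout removes \<open>u\<close>: as \<open>F n\<close> itself lies in
    \<open>W\<close>, divisibility of \<open>of_nat u * F n\<close> by \<open>p ^ j\<close> passes
    to \<open>F n\<close>.\<close>
  have "coprime (int u) (int p ^ j)" using uw(1) by simp
  then obtain x y where xy: "x * int u + y * int p ^ j = 1"
    by (metis bezout_int coprime_imp_gcd_eq_1)
  have "F n = of_int (x * int u + y * int p ^ j) * F n" using xy by simp
  also have "\<dots> = of_int x * (of_nat u * F n) + of_nat p ^ j * (of_int y * F n)"
    by (simp add: algebra_simps)
  also have "\<dots> = of_nat p ^ j * (of_int x * w + of_int y * F n)"
    unfolding uw(3) by (simp add: algebra_simps)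
  finally have "F n = of_nat p ^ j * (of_int x * w + of_int y * F n)" .
  moreover have "F n \<in> W" unfolding F_def using W b by (intro subring_intros)
  then have "of_int x * w + of_int y * F n \<in> W" using W uw by (auto intro!: subring_intros)
  ultimately show ?thesis unfolding F_def by blast
qed

text \<open>Choosing \<open>2 * j\<close> of the zeros for each \<open>j\<close> makes every value
  divisible by every power of \<open>p\<close>.\<close>

lemma newton_series_zero:
  fixes b :: "nat \<Rightarrow> complex"
  assumes W: "is_subring W" "separated p W" and p: "prime p" "p > 2" and b: "\<And>k. b k \<in> W"
    and inf: "infinite {n. (\<Sum>k\<le>n. of_nat (n choose k) * (of_nat p ^ k * b k)) = 0}"
  shows "(\<Sum>k\<le>n. of_nat (n choose k) * (of_nat p ^ k * b k)) = 0"
proof -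
  have "\<exists>w\<in>W. (\<Sum>k\<le>n. of_nat (n choose k) * (of_nat p ^ k * b k)) = of_nat p ^ j * w" for j
  proof -
    obtain T where T: "finite T" "card T = 2 * j"
      "T \<subseteq> {n. (\<Sum>k\<le>n. of_nat (n choose k) * (of_nat p ^ k * b k)) = 0}"
      using infinite_arbitrarily_large[OF inf] by blast
    show ?thesis
      by (rule newton_series_in_power[OF W(1) p b T(1)]) (use T in auto)
  qed
  then show ?thesis using W(2) unfolding separated_def by blast
qed

section \<open>Models of finitely generated subfields\<close>

text \<open>Powers of an inverse of \<open>p\<close> in \<open>W\<close> would make 1 divisible by
  every \<open>p ^ k\<close>.\<close>

lemma separated_unit:
  assumes "is_subring W" "separated p W" "w \<in> W"
  shows "of_nat p * w \<noteq> (1 :: complex)"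
proof
  assume 1: "of_nat p * w = (1 :: complex)"
  have "\<exists>v\<in>W. 1 = of_nat p ^ k * v" for k
    using 1 subring_power[OF assms(1,3)] by (intro bexI[of _ "w ^ k"]) (simp_all flip: power_mult_distrib)
  then have "(1 :: complex) = 0" using assms(2) unfolding separated_def by blast
  then show False by simp
qed

lemma poly_eq_sum_upto:
  fixes x :: complex
  assumes "\<forall>i\<ge>n. coeff r i = 0"
  shows "poly r x = (\<Sum>i<n. coeff r i * x ^ i)"
proof -
  have "(\<Sum>i\<le>degree r. coeff r i * x ^ i) = (\<Sum>i\<in>{..degree r} \<union> {..<n}. coeff r i * x ^ i)"
    by (intro sum.mono_neutral_left) (auto simp: coeff_eq_0)
  also have "\<dots> = (\<Sum>i<n. coeff r i * x ^ i)"
    by (intro sum.mono_neutral_right) (use assms in \<open>auto simp: not_less\<close>)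
  finally show ?thesis by (simp add: poly_altdef)
qed

text \<open>\<open>W\<close> stands in for the \<open>p\<close>-adic integers. Only the residues of the smaller ring \<open>Z\<close> are required to
  be finite in number, because adjoining a transcendental element makes \<open>W\<close> modulo \<open>p\<close> infinite.\<close>

definition padic_model :: "nat \<Rightarrow> complex set \<Rightarrow> complex set \<Rightarrow> bool" where
  "padic_model p Z W \<longleftrightarrow>
     prime p \<and> p > 2 \<and> is_subring Z \<and> is_subring W \<and> Z \<subseteq> W \<and> separated p W \<and>
     (\<exists>F. finite F \<and> (\<forall>z\<in>Z. \<exists>f\<in>F. \<exists>w\<in>W. z = f + of_nat p * w))"

text \<open>The property that survives adjoining one element at a time. The model is chosen after
  \<open>S\<close>, so its prime can avoid the denominators that \<open>S\<close> forces;
  \<open>W \<subseteq> K\<close> lets polynomial relations over \<open>W\<close> be judged over the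
  field \<open>K\<close>. The clause on inverses includes 0, since
  \<open>inverse 0 = 0\<close>.\<close>

definition modelled_field :: "complex set \<Rightarrow> bool" where
  "modelled_field K \<longleftrightarrow>
     is_subring K \<and> (\<forall>x\<in>K. inverse x \<in> K) \<and>
     (\<forall>S. finite S \<longrightarrow> S \<subseteq> K \<longrightarrow> (\<exists>p Z W. padic_model p Z W \<and> S \<subseteq> Z \<and> W \<subseteq> K))"

section \<open>The field of rational numbers\<close>

lemma common_denominator_Rats:
  assumes "finite S" "S \<subseteq> (\<rat> :: complex set)"
  shows "\<exists>d>0. \<forall>s\<in>S. of_nat d * s \<in> \<int>"
  using assms
proof (induction S)
  case (insert s S)
  then obtain d where d: "d > 0" "\<forall>s\<in>S. of_nat d * s \<in> \<int>" by auto
  obtain q where q: "s = of_rat q" using insert.prems by (auto elim: Rats_cases)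
  obtain a b where ab: "quotient_of q = (a, b)" by force
  have b: "b > 0" "q = of_int a / of_int b"
    using ab quotient_of_denom_pos quotient_of_div by auto
  then have sb: "of_nat (nat b) * s = of_int a"
    using q by (simp add: of_rat_divide)
  have "of_nat (d * nat b) * x \<in> \<int>" if "x \<in> insert s S" for x
  proof (cases "x = s")
    case True
    then have "of_nat (d * nat b) * x = of_nat d * of_int a" using sb by (simp add: mult.assoc)
    then show ?thesis by (simp del: of_nat_mult)
  next
    case False
    then have "of_nat d * x \<in> \<int>" using that d by auto
    then have "of_nat (nat b) * (of_nat d * x) \<in> \<int>" by (rule Ints_mult[OF Ints_of_nat])
    then show ?thesis by (simp only: of_nat_mult mult_ac)
  qed
  then show ?case using d b by (intro exI[of _ "d * nat b"]) auto
qed auto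

text \<open>The integers localised at a prime beyond a common denominator of \<open>S\<close> serve
  as both rings of the model.\<close>

lemma modelled_field_Rats: "modelled_field \<rat>"
  unfolding modelled_field_def
proof (intro conjI allI impI ballI)
  show "is_subring (\<rat> :: complex set)" by (auto simp: is_subring_def)
  show "inverse x \<in> \<rat>" if "x \<in> \<rat>" for x :: complex using that by simp
  fix S :: "complex set"
  assume S: "finite S" "S \<subseteq> \<rat>"
  obtain d where d: "d > 0" "\<forall>s\<in>S. of_nat d * s \<in> \<int>" using common_denominator_Rats[OF S] by auto
  \<comment> \<open>The bound makes \<open>p\<close> prime to the common denominator
    \<open>d\<close> and larger than 2.\<close>
  obtain p where p: "prime p" "p > d + 2" using bigger_prime by blast
  define W where "W = {x :: complex. \<exists>u n. coprime u p \<and> of_nat u * x = of_int n}"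
  have nz: "u \<noteq> 0" if "coprime u p" for u using that p by (cases "u = 0") auto
  have W: "is_subring W" unfolding is_subring_def
  proof (intro conjI ballI)
    show "1 \<in> W" unfolding W_def by (intro CollectI exI[of _ 1]) auto
    fix x y assume "x \<in> W" "y \<in> W"
    then obtain u n v m where uv: "coprime u p" "coprime v p"
      "of_nat u * x = of_int n" "of_nat v * y = of_int m"
      unfolding W_def by blast
    have "of_nat (u * v) * (x - y) = of_nat v * (of_nat u * x) - of_nat u * (of_nat v * y)"
      by (simp add: algebra_simps)
    also have "\<dots> = of_int (int v * n - int u * m)" using uv by simp
    finally show "x - y \<in> W"
      using uv unfolding W_def by (intro CollectI exI[of _ "u * v"] exI[of _ "int v * n - int u * m"]) auto
    have "of_nat (u * v) * (x * y) = (of_nat u * x) * (of_nat v * y)"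
      by (simp add: algebra_simps)
    also have "\<dots> = of_int (n * m)" using uv by simp
    finally show "x * y \<in> W"
      using uv unfolding W_def by (intro CollectI exI[of _ "u * v"] exI[of _ "n * m"]) auto
  qed
  have "separated p W" unfolding separated_def
  proof (intro allI impI)
    fix x :: complex assume x: "\<forall>k. \<exists>w\<in>W. x = of_nat p ^ k * w"
    then obtain w0 where "w0 \<in> W" "x = w0" by (metis mult_1 power_0)
    then obtain u n where un: "coprime u p" "of_nat u * x = of_int n" unfolding W_def by blast
    have dvd: "int p ^ k dvd n" for k
    proof -
      obtain w where w: "w \<in> W" "x = of_nat p ^ k * w" using x by blast
      then obtain v m where vm: "coprime v p" "of_nat v * w = of_int m" unfolding W_def by blast
      have "of_int (int v * n) = of_nat v * (of_nat u * x)" using un by simp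
      also have "\<dots> = of_nat u * of_nat p ^ k * (of_nat v * w)" unfolding w(2) by (simp add: mult_ac)
      also have "\<dots> = of_int (int u * int p ^ k * m)" using vm by simp
      finally have "int v * n = int u * int p ^ k * m" by (simp only: of_int_eq_iff)
      then have "int p ^ k dvd int v * n" by simp
      moreover have "coprime (int p ^ k) (int v)" using vm(1) by (simp add: coprime_commute)
      ultimately show ?thesis using coprime_dvd_mult_right_iff by blast
    qed
    have "n = 0"
    proof (rule ccontr)
      assume n: "n \<noteq> 0"
      have "nat \<bar>n\<bar> < 2 ^ nat \<bar>n\<bar>" by simp
      also have "\<dots> \<le> p ^ nat \<bar>n\<bar>" using p by (intro power_mono) auto
      finally have "\<bar>n\<bar> < int p ^ nat \<bar>n\<bar>" by (simp flip: of_nat_power)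
      then show False using dvd[of "nat \<bar>n\<bar>"] n by (meson dvd_imp_le_int not_less abs_ge_self dual_order.trans)
    qed
    then show "x = 0" using un nz by auto
  qed
  moreover have "\<exists>f\<in>of_nat ` {..<p}. \<exists>w\<in>W. z = f + of_nat p * w" if z: "z \<in> W" for z
  proof -
    obtain u n where un: "coprime u p" "of_nat u * z = of_int n" using z unfolding W_def by blast
    have "coprime (int u) (int p)" using un by simp
    \<comment> \<open>\<open>a\<close> inverts \<open>u\<close> modulo \<open>p\<close>, so the
      residue of \<open>z\<close>, which is \<open>n\<close> over \<open>u\<close>, is that of
      \<open>n * a\<close>.\<close>
    then obtain a b where ab: "a * int u + b * int p = 1"
      by (metis bezout_int coprime_imp_gcd_eq_1)
    define f where "f = (n * a) mod int p"
    define c where "c = (n * a) div int p"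
    have fc: "n * a = f + int p * c" unfolding f_def c_def by simp
    have f: "0 \<le> f" "f < int p" using p by (auto simp: f_def)
    have "n = n * (a * int u + b * int p)" using ab by simp
    also have "\<dots> = int u * (n * a) + int p * (n * b)" by (simp add: algebra_simps)
    also have "\<dots> = int u * f + int p * (int u * c + n * b)" unfolding fc by (simp add: algebra_simps)
    finally have n: "n = int u * f + int p * (int u * c + n * b)" .
    define w where "w = (z - of_int f) / of_nat p"
    have p0: "of_nat p \<noteq> (0 :: complex)" using p by simp
    have "of_nat u * z = of_nat u * of_int f + of_nat p * of_int (int u * c + n * b)"
      unfolding un(2) by (subst n) simp
    then have "of_nat u * w = of_int (int u * c + n * b)"
      unfolding w_def using p0 by (simp add: field_simps)
    then have "w \<in> W" unfolding W_def using un(1) by blast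
    moreover have "z = of_nat (nat f) + of_nat p * w" using p0 f by (simp add: w_def)
    moreover have "nat f < p" using f by auto
    ultimately show ?thesis by blast
  qed
  ultimately have "padic_model p W W"
    using p W unfolding padic_model_def by (intro conjI exI[of _ "of_nat ` {..<p}"]) auto
  moreover have "S \<subseteq> W"
  proof
    fix s assume "s \<in> S"
    then have "of_nat d * s \<in> \<int>" using d by auto
    then obtain n where "of_nat d * s = of_int n" by (auto elim: Ints_cases)
    moreover have "\<not> p dvd d" using p d by (auto dest: dvd_imp_le)
    then have "coprime d p" using p prime_imp_coprime coprime_commute by blast
    ultimately show "s \<in> W" unfolding W_def by blast
  qed
  moreover have "W \<subseteq> \<rat>"
  proof
    fix x assume "x \<in> W"
    then obtain u n where "coprime u p" "of_nat u * x = of_int n" unfolding W_def by blast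
    then have "x = of_int n / of_nat u" using nz[of u] by (simp add: field_simps)
    then show "x \<in> \<rat>" by simp
  qed
  ultimately show "\<exists>p Z W. padic_model p Z W \<and> S \<subseteq> Z \<and> W \<subseteq> \<rat>" by blast
qed

section \<open>Adjoining an algebraic element\<close>

lemma minimal_polynomial:
  fixes t :: complex
  assumes K: "is_subring K" "\<forall>x\<in>K. inverse x \<in> K"
    and alg: "f0 \<in> polys_over K" "f0 \<noteq> 0" "poly f0 t = 0"
  obtains f where "f \<in> polys_over K" "lead_coeff f = 1" "poly f t = 0"
    "\<And>g. g \<in> polys_over K \<Longrightarrow> poly g t = 0 \<Longrightarrow> (\<forall>i\<ge>degree f. coeff g i = 0) \<Longrightarrow> g = 0"
proof -
  define P where "P = (\<lambda>f. f \<in> polys_over K \<and> f \<noteq> 0 \<and> poly f t = 0)"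
  obtain h where h: "P h" "\<And>g. P g \<Longrightarrow> degree h \<le> degree g"
    using exists_least_iff[of "\<lambda>n. \<exists>f. P f \<and> degree f = n"] alg unfolding P_def
    by (metis not_le)
  define f where "f = smult (inverse (lead_coeff h)) h"
  have deg: "degree f = degree h" using h(1) by (simp add: f_def P_def)
  show thesis
  proof (rule that[of f])
    show "f \<in> polys_over K" using h(1) K by (auto simp: f_def P_def coeff_polys_over intro!: smult_polys_over)
    show "lead_coeff f = 1" "poly f t = 0" using h(1) by (auto simp: f_def P_def)
    fix g assume g: "g \<in> polys_over K" "poly g t = 0" "\<forall>i\<ge>degree f. coeff g i = 0"
    show "g = 0"
    proof (rule ccontr)
      assume "g \<noteq> 0"
      then have "degree h \<le> degree g" using h(2) g by (auto simp: P_def)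
      then have "lead_coeff g = 0" using g(3) deg by auto
      then show False using \<open>g \<noteq> 0\<close> by simp
    qed
  qed
qed

text \<open>The Euclidean algorithm against the minimal polynomial \<open>f\<close>: the remainder
  of \<open>f\<close> modulo \<open>g\<close> has smaller degree, and at \<open>t\<close> it is
  minus a multiple of the value of \<open>g\<close>, so an inverse of the remainder yields one of
  \<open>g\<close>.\<close>

lemma simple_algebraic_extension_inverse:
  fixes t :: complex
  assumes K: "is_subring K" "\<forall>x\<in>K. inverse x \<in> K"
    and f: "f \<in> polys_over K" "lead_coeff f = 1" "poly f t = 0"
    and min: "\<And>g. g \<in> polys_over K \<Longrightarrow> poly g t = 0 \<Longrightarrow> (\<forall>i\<ge>degree f. coeff g i = 0) \<Longrightarrow> g = 0"
    and g: "g \<in> polys_over K" "g \<noteq> 0" "degree g < degree f"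
  shows "\<exists>h\<in>polys_over K. poly g t * poly h t = 1"
  using g
proof (induction "degree g" arbitrary: g rule: less_induct)
  case less
  note R = subring_polys_over[OF K(1)]
  define c where "c = inverse (lead_coeff g)"
  have c: "c \<in> K" "c \<noteq> 0" using less.prems K by (auto simp: c_def coeff_polys_over)
  define g1 where "g1 = smult c g"
  have g1: "g1 \<in> polys_over K" "lead_coeff g1 = 1" "degree g1 = degree g" "g1 \<noteq> 0"
    using c less.prems K by (auto simp: g1_def c_def smult_polys_over)
  show ?case
  proof (cases "degree g = 0")
    case True
    then have "poly g t = lead_coeff g" by (auto elim!: degree_eq_zeroE)
    then show ?thesis
      using c less.prems(2) zero_polys_over[OF K(1)] unfolding c_def
      by (intro bexI[of _ "[:inverse (lead_coeff g):]"]) (auto simp: pCons_polys_over)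
  next
    case False
    obtain s r where sr: "s \<in> polys_over K" "r \<in> polys_over K" "f = g1 * s + r"
      "\<forall>i\<ge>degree g. coeff r i = 0"
      using monic_division[OF K(1) g1(1,2) f(1)] g1(3) by auto
    have eval: "poly g1 t * poly s t + poly r t = 0" using f(3) sr(3) by simp
    have g1t: "poly g1 t \<noteq> 0" using min[OF g1(1)] g1 less.prems(3) by (auto simp: coeff_eq_0)
    \<comment> \<open>Irreducibility of \<open>f\<close>: if \<open>g1\<close> divided it, the
      cofactor \<open>s\<close> would be a nonzero polynomial of smaller degree vanishing at
      \<open>t\<close>.\<close>
    have "r \<noteq> 0"
    proof
      assume r: "r = 0"
      then have st: "poly s t = 0" using eval g1t by simp
      have "s \<noteq> 0" using r sr(3) f(2) by auto
      have "degree f = degree g + degree s"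
        using r sr(3) g1 \<open>s \<noteq> 0\<close> by (simp add: degree_mult_eq)
      then have "\<forall>i\<ge>degree f. coeff s i = 0" using False by (simp add: coeff_eq_0)
      then show False using min[OF sr(1) st] \<open>s \<noteq> 0\<close> by blast
    qed
    then have "degree r < degree g" using sr(4) by (metis leading_coeff_0_iff not_le)
    then obtain h where h: "h \<in> polys_over K" "poly r t * poly h t = 1"
      using less.hyps[of r] sr(2) \<open>r \<noteq> 0\<close> less.prems(3) by auto
    have "poly g t * poly (- smult c (s * h)) t = - (poly g1 t * poly s t) * poly h t"
      by (simp add: g1_def)
    also have "\<dots> = poly r t * poly h t" using minus_unique[OF eval] by simp
    finally show ?thesis
      using h sr(1) c K R by (intro bexI[of _ "- smult c (s * h)"]) (auto intro!: smult_polys_over subring_intros)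
  qed
qed

lemma subring_poly_image:
  assumes "is_subring W"
  shows "is_subring ((\<lambda>q. poly q t) ` polys_over W)"
proof -
  note R = subring_polys_over[OF assms]
  show ?thesis unfolding is_subring_def
  proof (intro conjI ballI)
    show "1 \<in> (\<lambda>q. poly q t) ` polys_over W"
      using subring_1[OF R] by (intro image_eqI[of _ _ 1]) auto
    fix x y assume "x \<in> (\<lambda>q. poly q t) ` polys_over W" "y \<in> (\<lambda>q. poly q t) ` polys_over W"
    then obtain f g where "f \<in> polys_over W" "g \<in> polys_over W" "x = poly f t" "y = poly g t" by blast
    then show "x - y \<in> (\<lambda>q. poly q t) ` polys_over W" "x * y \<in> (\<lambda>q. poly q t) ` polys_over W"
      using subring_diff[OF R] subring_mult[OF R]
      by (auto intro: image_eqI[of _ _ "f - g"] image_eqI[of _ _ "f * g"])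
  qed
qed

text \<open>K[t] is already a field. Once the coefficients of the minimal polynomial
  \<open>f\<close> lie in \<open>Z\<close>, division by \<open>f\<close> makes the powers of
  \<open>t\<close> below \<open>degree f\<close> a basis of Z[t] over \<open>Z\<close> and of W[t]
  over \<open>W\<close>. Separatedness and finiteness of residues can then be checked on
  coordinates.\<close>

lemma modelled_field_algebraic:
  fixes t :: complex
  assumes good: "modelled_field K"
    and alg: "f0 \<in> polys_over K" "f0 \<noteq> 0" "poly f0 t = 0"
  shows "modelled_field ((\<lambda>q. poly q t) ` polys_over K)"
proof -
  have K: "is_subring K" "\<forall>x\<in>K. inverse x \<in> K"
    and model: "\<And>S. finite S \<Longrightarrow> S \<subseteq> K \<Longrightarrow> \<exists>p Z W. padic_model p Z W \<and> S \<subseteq> Z \<and> W \<subseteq> K"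
    using good by (auto simp: modelled_field_def)
  obtain f where f: "f \<in> polys_over K" "lead_coeff f = 1" "poly f t = 0"
    and min: "\<And>g. g \<in> polys_over K \<Longrightarrow> poly g t = 0 \<Longrightarrow> (\<forall>i\<ge>degree f. coeff g i = 0) \<Longrightarrow> g = 0"
    using minimal_polynomial[OF K alg] by blast
  define n where "n = degree f"
  let ?ev = "\<lambda>q. poly q t"
  have reduce: "\<exists>r\<in>polys_over V. x = poly r t \<and> (\<forall>i\<ge>n. coeff r i = 0)"
    if "is_subring V" "f \<in> polys_over V" "x \<in> ?ev ` polys_over V" for V x
  proof -
    obtain q where "q \<in> polys_over V" "x = poly q t" using \<open>x \<in> _\<close> by blast
    then show ?thesis
      using monic_division[OF that(1,2) f(2)] f(3) unfolding n_def by fastforce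
  qed
  show ?thesis unfolding modelled_field_def
  proof (intro conjI ballI allI impI)
    show "is_subring (?ev ` polys_over K)" by (rule subring_poly_image[OF K(1)])
    show "inverse x \<in> ?ev ` polys_over K" if x: "x \<in> ?ev ` polys_over K" for x
    proof (cases "x = 0")
      case False
      obtain r where r: "r \<in> polys_over K" "x = poly r t" "\<forall>i\<ge>n. coeff r i = 0"
        using reduce[OF K(1) f(1) x] by blast
      then have "r \<noteq> 0" using False by auto
      then have "degree r < degree f" using r(3) unfolding n_def by (metis leading_coeff_0_iff not_le)
      then obtain h where "h \<in> polys_over K" "x * poly h t = 1"
        using simple_algebraic_extension_inverse[OF K f min r(1) \<open>r \<noteq> 0\<close>] r(2) by blast
      moreover from this have "inverse x = poly h t" by (metis inverse_unique)
      ultimately show ?thesis by blast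
    qed (use x in auto)
    fix S assume S: "finite S" "S \<subseteq> ?ev ` polys_over K"
    then have "\<forall>s\<in>S. \<exists>q\<in>polys_over K. s = poly q t" by blast
    then obtain q where q: "\<And>s. s \<in> S \<Longrightarrow> q s \<in> polys_over K" "\<And>s. s \<in> S \<Longrightarrow> s = poly (q s) t"
      by metis
    \<comment> \<open>Besides the coefficients that represent \<open>S\<close>, those of
      \<open>f\<close> are included, so that \<open>t\<close> becomes integral over
      \<open>Z\<close>.\<close>
    define S' where "S' = (\<Union>g\<in>insert f (q ` S). coeff g ` {..degree g})"
    have "finite S'" "S' \<subseteq> K"
      using S(1) q(1) f(1) by (auto simp: S'_def coeff_polys_over)
    from model[OF this] obtain p Z W where m: "padic_model p Z W" "S' \<subseteq> Z" "W \<subseteq> K" by blast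
    then have p: "prime p" "p > 2" and Z: "is_subring Z" and W: "is_subring W" and ZW: "Z \<subseteq> W"
      and sep: "separated p W" by (auto simp: padic_model_def)
    obtain F where F: "finite F" "\<forall>z\<in>Z. \<exists>f\<in>F. \<exists>w\<in>W. z = f + of_nat p * w"
      using m(1) by (auto simp: padic_model_def)
    have inZ: "g \<in> polys_over Z" if "g \<in> insert f (q ` S)" for g
      unfolding polys_over_def
    proof (intro CollectI allI)
      fix i show "coeff g i \<in> Z"
      proof (cases "i \<le> degree g")
        case True
        then have "coeff g i \<in> S'" using that unfolding S'_def by blast
        then show ?thesis using m(2) by blast
      qed (auto simp: coeff_eq_0 subring_0[OF Z])
    qed
    have fZ: "f \<in> polys_over Z" and fW: "f \<in> polys_over W"
      using inZ[of f] polys_over_mono[OF ZW] by auto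
    have "separated p (?ev ` polys_over W)" (is "separated p ?W") unfolding separated_def
    proof (intro allI impI)
      fix x assume x: "\<forall>k. \<exists>w\<in>?ev ` polys_over W. x = of_nat p ^ k * w"
      have "\<exists>r. r \<in> polys_over W \<and> x = of_nat p ^ k * poly r t \<and> (\<forall>i\<ge>n. coeff r i = 0)" for k
        using x reduce[OF W fW] by metis
      then obtain r where r: "\<And>k. r k \<in> polys_over W" "\<And>k. x = of_nat p ^ k * poly (r k) t"
        "\<And>k i. i \<ge> n \<Longrightarrow> coeff (r k) i = 0" by metis
      \<comment> \<open>Reduced representations are unique by minimality of \<open>f\<close>, so
        divisibility of \<open>x\<close> by \<open>p ^ k\<close> passes to each coefficient of
        \<open>r 0\<close>.\<close>
      have rk: "r 0 = smult (of_nat p ^ k) (r k)" for k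
      proof -
        have "r 0 - smult (of_nat p ^ k) (r k) = 0"
        proof (rule min)
          show "r 0 - smult (of_nat p ^ k) (r k) \<in> polys_over K"
            using polys_over_mono[OF m(3)] r(1)
            by (intro subring_diff[OF subring_polys_over[OF K(1)]] smult_polys_over K(1)
                subring_power[OF K(1)] subring_of_nat[OF K(1)]) blast+
          show "poly (r 0 - smult (of_nat p ^ k) (r k)) t = 0" using r(2)[of 0] r(2)[of k] by simp
          show "\<forall>i\<ge>degree f. coeff (r 0 - smult (of_nat p ^ k) (r k)) i = 0"
            using r(3) unfolding n_def by simp
        qed
        then show ?thesis by simp
      qed
      have "coeff (r 0) i = 0" for i
      proof -
        have "\<exists>w\<in>W. coeff (r 0) i = of_nat p ^ k * w" for k
          using arg_cong[OF rk[of k], of "\<lambda>g. coeff g i"] coeff_polys_over[OF r(1)] by auto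
        then show ?thesis using sep unfolding separated_def by blast
      qed
      then have "r 0 = 0" by (intro poly_eqI) auto
      then show "x = 0" using r(2)[of 0] by simp
    qed
    \<comment> \<open>One candidate representative for each choice of \<open>n\<close> coordinate
      residues from \<open>F\<close>.\<close>
    moreover define E where "E = (\<lambda>c. \<Sum>i<n. c i * t ^ i) ` (PiE {..<n} (\<lambda>_. F))"
    have "\<forall>z\<in>?ev ` polys_over Z. \<exists>y\<in>E. \<exists>w\<in>?W. z = y + of_nat p * w"
    proof
      fix z assume z: "z \<in> ?ev ` polys_over Z"
      obtain r where r: "r \<in> polys_over Z" "z = poly r t" "\<forall>i\<ge>n. coeff r i = 0"
        using reduce[OF Z fZ z] by blast
      have "\<forall>i. \<exists>c w. c \<in> F \<and> w \<in> W \<and> coeff r i = c + of_nat p * w"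
        using F(2) r(1) coeff_polys_over by blast
      then obtain c w where cw: "\<And>i. c i \<in> F" "\<And>i. w i \<in> W" "\<And>i. coeff r i = c i + of_nat p * w i"
        by metis
      define v where "v = (\<Sum>i<n. monom (w i) i)"
      have "v \<in> polys_over W" unfolding v_def
        using subring_polys_over[OF W] monom_polys_over[OF W cw(2)] by (intro subring_sum)
      moreover have "z = (\<Sum>i<n. c i * t ^ i) + of_nat p * poly v t"
        unfolding r(2) poly_eq_sum_upto[OF r(3)] v_def
        by (simp add: cw(3) poly_sum poly_monom algebra_simps sum.distrib sum_distrib_left)
      moreover have "(\<Sum>i<n. c i * t ^ i) = (\<Sum>i<n. restrict c {..<n} i * t ^ i)" by simp
      moreover have "restrict c {..<n} \<in> PiE {..<n} (\<lambda>_. F)" using cw(1) by auto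
      ultimately show "\<exists>y\<in>E. \<exists>w\<in>?W. z = y + of_nat p * w" unfolding E_def by blast
    qed
    moreover have "finite E"
      unfolding E_def using F(1) by (intro finite_imageI finite_PiE) auto
    moreover have "?ev ` polys_over Z \<subseteq> ?W" using polys_over_mono[OF ZW] by (rule image_mono)
    ultimately have "padic_model p (?ev ` polys_over Z) ?W"
      using p subring_poly_image[OF Z] subring_poly_image[OF W]
      unfolding padic_model_def by simp metis
    moreover have "S \<subseteq> ?ev ` polys_over Z"
    proof
      fix s assume "s \<in> S"
      then show "s \<in> ?ev ` polys_over Z" using inZ[of "q s"] q(2)[of s] by (intro image_eqI[of _ _ "q s"]) auto
    qed
    moreover have "?W \<subseteq> ?ev ` polys_over K" using polys_over_mono[OF m(3)] by (rule image_mono)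
    ultimately show "\<exists>p Z W. padic_model p Z W \<and> S \<subseteq> Z \<and> W \<subseteq> ?ev ` polys_over K" by metis
  qed
qed

section \<open>Adjoining a transcendental element\<close>

lemma simple_extension_subfield:
  fixes t :: complex
  assumes K: "is_subring K"
    and tr: "\<And>g. g \<in> polys_over K \<Longrightarrow> poly g t = 0 \<Longrightarrow> g = 0"
  defines "L \<equiv> {poly h t / poly g t | h g. h \<in> polys_over K \<and> g \<in> polys_over K \<and> g \<noteq> 0}"
  shows "is_subring L" and "\<forall>x\<in>L. inverse x \<in> L"
proof -
  note R = subring_polys_over[OF K]
  have L: "poly h t / poly g t \<in> L" if "h \<in> polys_over K" "g \<in> polys_over K" "g \<noteq> 0" for h g
    using that unfolding L_def by blast
  show "is_subring L" unfolding is_subring_def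
  proof (intro conjI ballI)
    show "1 \<in> L" using L[of 1 1] subring_1[OF R] by simp
    fix x y assume "x \<in> L" "y \<in> L"
    then obtain h g h' g' where *: "x = poly h t / poly g t" "y = poly h' t / poly g' t"
      "h \<in> polys_over K" "g \<in> polys_over K" "g \<noteq> 0" "h' \<in> polys_over K" "g' \<in> polys_over K" "g' \<noteq> 0"
      unfolding L_def by blast
    have nz: "poly g t \<noteq> 0" "poly g' t \<noteq> 0" using tr * by blast+
    have "x - y = poly (h * g' - h' * g) t / poly (g * g') t"
      using nz by (simp add: *(1,2) diff_frac_eq)
    moreover have "h * g' - h' * g \<in> polys_over K" "g * g' \<in> polys_over K"
      using * R by (auto intro!: subring_intros)
    ultimately show "x - y \<in> L" using L[of "h * g' - h' * g" "g * g'"] * by simp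
    have "x * y = poly (h * h') t / poly (g * g') t" by (simp add: *(1,2))
    moreover have "h * h' \<in> polys_over K" using * R by (auto intro!: subring_intros)
    ultimately show "x * y \<in> L" using L[of "h * h'" "g * g'"] * \<open>g * g' \<in> polys_over K\<close> by simp
  qed
  show "\<forall>x\<in>L. inverse x \<in> L"
  proof
    fix x assume x: "x \<in> L"
    then obtain h g where *: "x = poly h t / poly g t" "h \<in> polys_over K" "g \<in> polys_over K"
      unfolding L_def by blast
    show "inverse x \<in> L"
    proof (cases "h = 0")
      \<comment> \<open>Here \<open>x = 0\<close>, and its inverse is again 0 by convention.\<close>
      case True
      then show ?thesis using x * by simp
    next
      case False
      then show ?thesis using L[OF *(3,2)] by (simp add: *(1))
    qed
  qed
qed

lemma common_denominator_fractions:
  fixes t :: complex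
  assumes K: "is_subring K"
    and tr: "\<And>g. g \<in> polys_over K \<Longrightarrow> poly g t = 0 \<Longrightarrow> g = 0"
    and S: "finite S"
    "S \<subseteq> {poly h t / poly g t | h g. h \<in> polys_over K \<and> g \<in> polys_over K \<and> g \<noteq> 0}"
  shows "\<exists>g\<in>polys_over K. g \<noteq> 0 \<and> (\<forall>s\<in>S. \<exists>h\<in>polys_over K. s = poly h t / poly g t)"
  using S
proof (induction S)
  case empty
  then show ?case using subring_1[OF subring_polys_over[OF K]] by (intro bexI[of _ 1]) auto
next
  case (insert s S)
  note R = subring_polys_over[OF K]
  obtain g where g: "g \<in> polys_over K" "g \<noteq> 0" "\<forall>s\<in>S. \<exists>h\<in>polys_over K. s = poly h t / poly g t"
    using insert by auto
  obtain h0 g0 where s: "s = poly h0 t / poly g0 t" "h0 \<in> polys_over K" "g0 \<in> polys_over K" "g0 \<noteq> 0"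
    using insert.prems by blast
  have nz: "poly g t \<noteq> 0" "poly g0 t \<noteq> 0" using tr g s by blast+
  have "\<exists>h\<in>polys_over K. x = poly h t / poly (g * g0) t" if x: "x \<in> insert s S" for x
  proof (cases "x = s")
    case True
    then show ?thesis using nz s(1) subring_mult[OF R g(1) s(2)]
      by (intro bexI[of _ "g * h0"]) auto
  next
    case False
    then obtain h where "h \<in> polys_over K" "x = poly h t / poly g t" using x g by blast
    then show ?thesis using nz subring_mult[OF R _ s(3)]
      by (intro bexI[of _ "h * g0"]) auto
  qed
  then show ?case using g s subring_mult[OF R g(1) s(3)] by (intro bexI[of _ "g * g0"]) auto
qed

text \<open>The localisation of \<open>W[\<tau>]\<close> at \<open>1 + p W[\<tau>]\<close>.\<close>

definition localized_polys :: "nat \<Rightarrow> complex \<Rightarrow> complex set \<Rightarrow> complex set" where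
  "localized_polys p \<tau> W =
     {x. \<exists>F\<in>polys_over W. \<exists>G\<in>polys_over W. x * (1 + of_nat p * poly G \<tau>) = poly F \<tau>}"

lemma subring_localized_polys:
  assumes W: "is_subring W"
  shows "is_subring (localized_polys p \<tau> W)"
  unfolding is_subring_def
proof (intro conjI ballI)
  note R = subring_polys_over[OF W]
  show "1 \<in> localized_polys p \<tau> W" unfolding localized_polys_def
    using subring_1[OF R] subring_0[OF R] by (intro CollectI bexI[of _ 1] bexI[of _ 0]) auto
  fix x y assume "x \<in> localized_polys p \<tau> W" "y \<in> localized_polys p \<tau> W"
  then obtain F G F' G' where *: "F \<in> polys_over W" "G \<in> polys_over W" "F' \<in> polys_over W" "G' \<in> polys_over W"
    "x * (1 + of_nat p * poly G \<tau>) = poly F \<tau>" "y * (1 + of_nat p * poly G' \<tau>) = poly F' \<tau>"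
    unfolding localized_polys_def by blast
  \<comment> \<open>Chosen so that \<open>1 + p H\<close> is the product of the two
    denominators.\<close>
  define H where "H = G + G' + of_nat p * (G * G')"
  have H: "H \<in> polys_over W" unfolding H_def using * R by (intro subring_intros)
  have eval: "1 + of_nat p * poly H \<tau> = (1 + of_nat p * poly G \<tau>) * (1 + of_nat p * poly G' \<tau>)"
    by (simp add: H_def algebra_simps)
  have "(x - y) * (1 + of_nat p * poly H \<tau>) =
      (x * (1 + of_nat p * poly G \<tau>)) * (1 + of_nat p * poly G' \<tau>)
      - (y * (1 + of_nat p * poly G' \<tau>)) * (1 + of_nat p * poly G \<tau>)"
    unfolding eval by (simp only: algebra_simps)
  also have "\<dots> = poly (F * (1 + of_nat p * G') - F' * (1 + of_nat p * G)) \<tau>"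
    unfolding * by simp
  finally show "x - y \<in> localized_polys p \<tau> W" unfolding localized_polys_def
    using H * R
    by (intro CollectI bexI[of _ "F * (1 + of_nat p * G') - F' * (1 + of_nat p * G)"] bexI[of _ H])
      (auto intro!: subring_intros)
  have "x * y * (1 + of_nat p * poly H \<tau>) =
      (x * (1 + of_nat p * poly G \<tau>)) * (y * (1 + of_nat p * poly G' \<tau>))"
    unfolding eval by (simp only: mult_ac)
  also have "\<dots> = poly (F * F') \<tau>" unfolding * by simp
  finally show "x * y \<in> localized_polys p \<tau> W" unfolding localized_polys_def
    using H * R by (intro CollectI bexI[of _ "F * F'"] bexI[of _ H]) (auto intro!: subring_intros)
qed

lemma subset_localized_polys:
  assumes "is_subring W"
  shows "W \<subseteq> localized_polys p \<tau> W"
proof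
  fix w assume "w \<in> W"
  then show "w \<in> localized_polys p \<tau> W" unfolding localized_polys_def
    using zero_polys_over[OF assms]
    by (intro CollectI bexI[of _ "[:w:]"] bexI[of _ 0]) (auto simp: pCons_polys_over)
qed

text \<open>Comparing constant coefficients in \<open>1 + p G = 0\<close> would make
  \<open>p\<close> a unit of \<open>W\<close>.\<close>

lemma one_plus_mult_nonzero:
  fixes W :: "complex set"
  assumes W: "is_subring W" "separated p W" and G: "G \<in> polys_over W"
  shows "1 + of_nat p * G \<noteq> 0"
proof
  assume 0: "1 + of_nat p * G = 0"
  have "of_nat p * - coeff G 0 = 1 - poly (1 + of_nat p * G) 0"
    unfolding poly_0_coeff_0[symmetric] by simp
  then have "of_nat p * - coeff G 0 = 1" unfolding 0 by simp
  moreover have "- coeff G 0 \<in> W" using subring_uminus[OF W(1)] coeff_polys_over[OF G] .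
  ultimately show False using separated_unit[OF W] by blast
qed

text \<open>As \<tau> is transcendental over \<open>W\<close>, clearing denominators turns the
  divisibility of \<open>x\<close> by \<open>p ^ k\<close> into an identity in W[X]. The
  denominators are units modulo \<open>p ^ k\<close>, so the fixed numerator \<open>F 0\<close> is
  divisible by every \<open>p ^ k\<close>, and its coefficients vanish because \<open>W\<close> is
  separated.\<close>

lemma separated_localized_polys:
  assumes W: "is_subring W" "separated p W"
    and tr: "\<And>g. g \<in> polys_over W \<Longrightarrow> poly g \<tau> = 0 \<Longrightarrow> g = 0"
  shows "separated p (localized_polys p \<tau> W)"
  unfolding separated_def
proof (intro allI impI)
  note R = subring_polys_over[OF W(1)]
  fix x assume "\<forall>k. \<exists>w\<in>localized_polys p \<tau> W. x = of_nat p ^ k * w"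
  then obtain w where w: "\<And>k. w k \<in> localized_polys p \<tau> W" "\<And>k. x = of_nat p ^ k * w k" by metis
  then have "\<forall>k. \<exists>F G. F \<in> polys_over W \<and> G \<in> polys_over W \<and> w k * (1 + of_nat p * poly G \<tau>) = poly F \<tau>"
    unfolding localized_polys_def by blast
  then obtain F G where FG: "\<And>k. F k \<in> polys_over W" "\<And>k. G k \<in> polys_over W"
    "\<And>k. w k * (1 + of_nat p * poly (G k) \<tau>) = poly (F k) \<tau>" by metis
  have dvd: "\<exists>U\<in>polys_over W. F 0 = of_nat p ^ k * U" for k
  proof -
    have "poly (F 0 * (1 + of_nat p * G k)) \<tau> = x * (1 + of_nat p * poly (G 0) \<tau>) * (1 + of_nat p * poly (G k) \<tau>)"
      using FG(3)[of 0] w(2)[of 0] by simp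
    also have "\<dots> = poly (of_nat p ^ k * F k * (1 + of_nat p * G 0)) \<tau>"
      using FG(3)[of k] w(2)[of k] by (simp add: mult_ac)
    finally have "poly (F 0 * (1 + of_nat p * G k) - of_nat p ^ k * F k * (1 + of_nat p * G 0)) \<tau> = 0" by simp
    then have "F 0 * (1 + of_nat p * G k) - of_nat p ^ k * F k * (1 + of_nat p * G 0) = 0"
      using FG(1,2) R by (intro tr subring_intros)
    then have eq: "F 0 * (1 + of_nat p * G k) = of_nat p ^ k * F k * (1 + of_nat p * G 0)" by simp
    txt \<open>Modulo \<open>p ^ k\<close>, the polynomial \<open>1 + p G\<^sub>k\<close> is inverted by a finite geometric series.\<close>
    define y where "y = - (of_nat p * G k)"
    define V where "V = (\<Sum>i<k. y ^ i)"
    have "y \<in> polys_over W" unfolding y_def using R FG(2) by (auto intro!: subring_intros)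
    then have V: "V \<in> polys_over W" unfolding V_def using R by (auto intro!: subring_intros)
    have "F 0 = F 0 * (1 - y ^ k) + F 0 * y ^ k" by (simp add: algebra_simps)
    also have "1 - y ^ k = (1 + of_nat p * G k) * V"
      unfolding V_def one_diff_power_eq by (simp add: y_def)
    also have "y ^ k = of_nat p ^ k * (- G k) ^ k"
      unfolding y_def by (simp flip: power_mult_distrib)
    also have "F 0 * ((1 + of_nat p * G k) * V) + F 0 * (of_nat p ^ k * (- G k) ^ k)
        = of_nat p ^ k * (F k * (1 + of_nat p * G 0) * V + F 0 * (- G k) ^ k)"
      unfolding mult.assoc[symmetric] eq by (simp add: algebra_simps)
    finally show ?thesis
      using FG V R by (intro bexI[of _ "F k * (1 + of_nat p * G 0) * V + F 0 * (- G k) ^ k"])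
        (auto intro!: subring_intros)
  qed
  have "coeff (F 0) i = 0" for i
  proof -
    have "\<exists>u\<in>W. coeff (F 0) i = of_nat p ^ k * u" for k
    proof -
      obtain U where U: "U \<in> polys_over W" "F 0 = of_nat p ^ k * U" using dvd by blast
      have "of_nat p ^ k * U = smult (of_nat p ^ k) U"
        by (metis mult_1 mult_smult_left of_nat_poly of_nat_power smult_one one_pCons)
      then show ?thesis using U coeff_polys_over[OF U(1)] by auto
    qed
    then show ?thesis using W(2) unfolding separated_def by blast
  qed
  then have "F 0 = 0" by (intro poly_eqI) auto
  moreover have "poly (1 + of_nat p * G 0) \<tau> \<noteq> 0"
    using one_plus_mult_nonzero[OF W FG(2)] tr[of "1 + of_nat p * G 0"] R FG(2) by (auto intro!: subring_intros)
  ultimately have "w 0 = 0" using FG(3)[of 0] by simp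
  then show "x = 0" using w(2)[of 0] by simp
qed

text \<open>Every term above the constant one contains the argument, hence a factor
  \<open>p\<close>. This is what the substitution of a multiple of \<open>p\<close> gains.\<close>

lemma poly_at_multiple:
  assumes Z: "is_subring Z" and Q: "Q \<in> polys_over Z"
  shows "\<exists>Q'\<in>polys_over Z. poly Q (of_nat p * \<tau>) = coeff Q 0 + of_nat p * poly Q' \<tau>"
proof -
  obtain c q where Qc: "Q = pCons c q" by (cases Q)
  then have q: "q \<in> polys_over Z" using Q by (simp add: pCons_polys_over)
  define Q' where "Q' = pCons 0 (pcompose q [:0, of_nat p:])"
  have "Q' \<in> polys_over Z" unfolding Q'_def
    using Z q by (auto simp: pCons_polys_over zero_polys_over intro!: pcompose_polys_over subring_intros)
  moreover have "poly Q (of_nat p * \<tau>) = coeff Q 0 + of_nat p * poly Q' \<tau>"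
    by (simp add: Qc Q'_def poly_pcompose mult_ac)
  ultimately show ?thesis by blast
qed

text \<open>After translating \<open>t\<close> by an integer at which the common denominator does not vanish, \<open>t\<close> itself is
  made divisible by \<open>p\<close>: then \<open>t\<close> contributes no residues and the denominators become units.\<close>

lemma modelled_field_transcendental:
  fixes t :: complex
  assumes good: "modelled_field K"
    and tr: "\<And>g. g \<in> polys_over K \<Longrightarrow> poly g t = 0 \<Longrightarrow> g = 0"
  shows "modelled_field {poly h t / poly g t | h g. h \<in> polys_over K \<and> g \<in> polys_over K \<and> g \<noteq> 0}"
    (is "modelled_field ?L")
proof -
  have K: "is_subring K" "\<forall>x\<in>K. inverse x \<in> K"
    and model: "\<And>S. finite S \<Longrightarrow> S \<subseteq> K \<Longrightarrow> \<exists>p Z W. padic_model p Z W \<and> S \<subseteq> Z \<and> W \<subseteq> K"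
    using good by (auto simp: modelled_field_def)
  note RK = subring_polys_over[OF K(1)]
  show ?thesis unfolding modelled_field_def
  proof (intro conjI allI impI)
    show "is_subring ?L" "\<forall>x\<in>?L. inverse x \<in> ?L"
      using simple_extension_subfield[OF K(1) tr] by blast+
    fix S assume S: "finite S" "S \<subseteq> ?L"
    obtain g where g: "g \<in> polys_over K" "g \<noteq> 0" "\<forall>s\<in>S. \<exists>h\<in>polys_over K. s = poly h t / poly g t"
      using common_denominator_fractions[OF K(1) tr S] by blast
    then obtain h where h: "\<And>s. s \<in> S \<Longrightarrow> h s \<in> polys_over K" "\<And>s. s \<in> S \<Longrightarrow> s = poly (h s) t / poly g t"
      by metis
    obtain a :: nat where a: "poly g (of_nat a) \<noteq> 0"
    proof -
      have "\<exists>a :: nat. poly g (of_nat a) \<noteq> 0"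
      proof (rule ccontr)
        assume "\<not> ?thesis"
        then have "range (of_nat :: nat \<Rightarrow> complex) \<subseteq> {x. poly g x = 0}" by auto
        then have "finite (range (of_nat :: nat \<Rightarrow> complex))"
          using poly_roots_finite[OF g(2)] finite_subset by blast
        then show False using finite_imageD[of of_nat UNIV] by (simp add: inj_on_def)
      qed
      then show thesis using that by blast
    qed
    define shift where "shift = (\<lambda>f :: complex poly. pcompose f [:of_nat a, 1:])"
    have shiftK: "shift f \<in> polys_over K" if "f \<in> polys_over K" for f
      unfolding shift_def using that K(1)
      by (intro pcompose_polys_over) (auto simp: pCons_polys_over zero_polys_over intro: subring_intros)
    have poly_shift: "poly (shift f) (t - of_nat a) = poly f t" for f
      by (simp add: shift_def poly_pcompose)
    define \<gamma> where "\<gamma> = coeff (shift g) 0"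
    have \<gamma>: "\<gamma> \<noteq> 0" using a unfolding \<gamma>_def shift_def by (simp add: poly_pcompose flip: poly_0_coeff_0)
    \<comment> \<open>Including \<open>inverse \<gamma>\<close> makes the constant term of the
      shifted denominator a unit of \<open>Z\<close>.\<close>
    define S' where "S' = insert (inverse \<gamma>) (\<Union>f\<in>insert g (h ` S). coeff (shift f) ` {..degree (shift f)})"
    have "finite S'" using S(1) by (simp add: S'_def)
    moreover have "\<gamma> \<in> K" unfolding \<gamma>_def using coeff_polys_over[OF shiftK[OF g(1)]] .
    then have "S' \<subseteq> K" using h(1) g(1) K(2) coeff_polys_over[OF shiftK] unfolding S'_def by auto
    ultimately obtain p Z W where m: "padic_model p Z W" "S' \<subseteq> Z" "W \<subseteq> K" using model[of S'] by auto
    then have p: "prime p" "p > 2" and Z: "is_subring Z" and W: "is_subring W" and ZW: "Z \<subseteq> W"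
      and sep: "separated p W" by (auto simp: padic_model_def)
    obtain F where F: "finite F" "\<forall>z\<in>Z. \<exists>f\<in>F. \<exists>w\<in>W. z = f + of_nat p * w"
      using m(1) by (auto simp: padic_model_def)
    have p0: "of_nat p \<noteq> (0 :: complex)" using p by simp
    define \<tau> where "\<tau> = (t - of_nat a) / of_nat p"
    have \<tau>: "of_nat p * \<tau> = t - of_nat a" using p0 by (simp add: \<tau>_def)
    \<comment> \<open>\<open>lin\<close> writes \<tau> as a polynomial in \<open>t\<close> over
      \<open>K\<close>; composing with it turns polynomials in \<tau> into polynomials in
      \<open>t\<close>.\<close>
    define lin where "lin = [:- (of_nat a / of_nat p), inverse (of_nat p) :: complex:]"
    have "inverse (of_nat p) \<in> K" using K(2) subring_of_nat[OF K(1)] by blast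
    then have lin: "lin \<in> polys_over K" unfolding lin_def divide_inverse
      using K(1) by (auto simp: pCons_polys_over zero_polys_over intro!: subring_intros)
    have lin_t: "poly lin t = \<tau>" using p0 by (simp add: lin_def \<tau>_def field_simps)
    have tau_tr: "f = 0" if "f \<in> polys_over K" "poly f \<tau> = 0" for f
    proof -
      have "pcompose f lin = 0"
        using tr[of "pcompose f lin"] pcompose_polys_over[OF K(1) that(1) lin] that(2) lin_t by (simp add: poly_pcompose)
      then show ?thesis using p0 by (subst (asm) pcompose_eq_0_iff) (auto simp: lin_def)
    qed
    let ?W = "localized_polys p \<tau> W"
    note W' = subring_localized_polys[OF W, of p \<tau>] and WW' = subset_localized_polys[OF W, of p \<tau>]
    \<comment> \<open>The localised ring enters only through multiples of \<open>p\<close>, so the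
      residues of \<open>Z'\<close> are represented by those of \<open>Z\<close>.\<close>
    define Z' where "Z' = {z + of_nat p * w | z w. z \<in> Z \<and> w \<in> ?W}"
    have "is_subring Z'" unfolding is_subring_def
    proof (intro conjI ballI)
      show "1 \<in> Z'" unfolding Z'_def using subring_1[OF Z] subring_0[OF W']
        by (intro CollectI exI[of _ 1] exI[of _ 0]) simp
      fix x y assume "x \<in> Z'" "y \<in> Z'"
      then obtain u v w w' where *: "u \<in> Z" "v \<in> Z" "w \<in> ?W" "w' \<in> ?W"
        "x = u + of_nat p * w" "y = v + of_nat p * w'" unfolding Z'_def by blast
      have uv: "u \<in> ?W" "v \<in> ?W" using * ZW WW' by blast+
      have "x - y = (u - v) + of_nat p * (w - w')" unfolding * by (simp add: algebra_simps)
      moreover have "u - v \<in> Z" "w - w' \<in> ?W" using * Z W' by (auto intro: subring_intros)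
      ultimately show "x - y \<in> Z'" unfolding Z'_def by blast
      have "x * y = u * v + of_nat p * (u * w' + w * v + of_nat p * (w * w'))"
        unfolding * by (simp add: algebra_simps)
      moreover have "u * w' + w * v + of_nat p * (w * w') \<in> ?W" using * uv W' by (intro subring_intros)
      moreover have "u * v \<in> Z" using * Z by (auto intro: subring_intros)
      ultimately show "x * y \<in> Z'" unfolding Z'_def by blast
    qed
    moreover have "separated p ?W"
      using polys_over_mono[OF m(3)] by (intro separated_localized_polys[OF W sep] tau_tr) auto
    moreover have "Z' \<subseteq> ?W"
    proof
      fix x assume "x \<in> Z'"
      then obtain z w where "x = z + of_nat p * w" "z \<in> ?W" "w \<in> ?W" unfolding Z'_def using ZW WW' by blast
      then show "x \<in> ?W" using W' by (auto intro!: subring_intros)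
    qed
    moreover have "\<forall>z\<in>Z'. \<exists>f\<in>F. \<exists>w\<in>?W. z = f + of_nat p * w"
    proof
      fix x assume "x \<in> Z'"
      then obtain z w where zw: "x = z + of_nat p * w" "z \<in> Z" "w \<in> ?W" unfolding Z'_def by blast
      obtain f v where fv: "f \<in> F" "v \<in> W" "z = f + of_nat p * v" using F(2) zw(2) by blast
      have "x = f + of_nat p * (v + w)" using zw fv by (simp add: algebra_simps)
      moreover have "v + w \<in> ?W" using fv zw WW' W' by (auto intro!: subring_intros)
      ultimately show "\<exists>f\<in>F. \<exists>w\<in>?W. x = f + of_nat p * w" using fv(1) by blast
    qed
    ultimately have "padic_model p Z' ?W"
      using p W' F(1) unfolding padic_model_def by metis
    moreover have "S \<subseteq> Z'"
    proof
      fix s assume s: "s \<in> S"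
      have inZ: "shift f \<in> polys_over Z" if "f \<in> insert g (h ` S)" for f
        unfolding polys_over_def
      proof (intro CollectI allI)
        fix i show "coeff (shift f) i \<in> Z"
        proof (cases "i \<le> degree (shift f)")
          case True
          then have "coeff (shift f) i \<in> S'" using that unfolding S'_def by blast
          then show ?thesis using m(2) by blast
        qed (auto simp: coeff_eq_0 subring_0[OF Z])
      qed
      define c where "c = inverse \<gamma>"
      have c: "c \<in> Z" using m(2) unfolding c_def S'_def by blast
      obtain Q where Q: "Q \<in> polys_over Z" "poly (shift g) (of_nat p * \<tau>) = \<gamma> + of_nat p * poly Q \<tau>"
        using poly_at_multiple[OF Z inZ[of g]] unfolding \<gamma>_def by auto
      define H0 where "H0 = coeff (shift (h s)) 0"
      have H0: "H0 \<in> Z" unfolding H0_def using inZ s by (intro coeff_polys_over) auto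
      obtain P where P: "P \<in> polys_over Z" "poly (shift (h s)) (of_nat p * \<tau>) = H0 + of_nat p * poly P \<tau>"
        using poly_at_multiple[OF Z inZ[of "h s"]] s unfolding H0_def by auto
      have gt: "poly g t = \<gamma> + of_nat p * poly Q \<tau>" and ht: "poly (h s) t = H0 + of_nat p * poly P \<tau>"
        using Q P by (simp_all add: \<tau> poly_shift)
      have gt0: "poly g t \<noteq> 0" using tr g by blast
      have gt1: "1 + of_nat p * poly (smult c Q) \<tau> = c * poly g t"
        using \<gamma> by (simp add: gt c_def field_simps)
      have st: "s * poly g t = poly (h s) t" using h(2)[OF s] gt0 by (simp add: field_simps)
      \<comment> \<open>After multiplication by \<open>c\<close>, the inverse of \<gamma>, the
        denominator of \<open>s\<close> is \<open>1 + p c Q\<close> and the numerator is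
        \<open>c H0 + p c P\<close>, both at \<tau>. Hence \<open>s\<close> is congruent to
        \<open>c * H0\<close> modulo \<open>p\<close>, and \<open>w\<close> is the difference
        divided by \<open>p\<close>.\<close>
      define w where "w = (s - c * H0) / of_nat p"
      have "w * (1 + of_nat p * poly (smult c Q) \<tau>) = (c * (s * poly g t) - c * H0 * (c * poly g t)) / of_nat p"
        unfolding gt1 by (simp add: w_def algebra_simps)
      also have "\<dots> = (c * (H0 + of_nat p * poly P \<tau>) - c * H0 * (1 + of_nat p * poly (smult c Q) \<tau>)) / of_nat p"
        unfolding st ht gt1 ..
      also have "\<dots> = poly (smult c P - smult (c * H0) (smult c Q)) \<tau>"
        using p0 by (simp add: field_simps)
      finally have eq: "w * (1 + of_nat p * poly (smult c Q) \<tau>) = poly (smult c P - smult (c * H0) (smult c Q)) \<tau>" .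
      have "smult c P - smult (c * H0) (smult c Q) \<in> polys_over Z"
        using c H0 P Q Z by (intro subring_diff[OF subring_polys_over[OF Z]] smult_polys_over subring_mult)
      moreover have "smult c Q \<in> polys_over Z" using c Q Z by (intro smult_polys_over)
      ultimately have "w \<in> ?W"
        using eq polys_over_mono[OF ZW] unfolding localized_polys_def by blast
      moreover have "s = c * H0 + of_nat p * w" using p0 by (simp add: w_def)
      moreover have "c * H0 \<in> Z" using c H0 Z by (intro subring_mult)
      ultimately show "s \<in> Z'" unfolding Z'_def by blast
    qed
    moreover have "?W \<subseteq> ?L"
    proof
      fix x assume "x \<in> ?W"
      then obtain P Q where PQ: "P \<in> polys_over W" "Q \<in> polys_over W"
        "x * (1 + of_nat p * poly Q \<tau>) = poly P \<tau>" unfolding localized_polys_def by blast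
      have PQK: "P \<in> polys_over K" "Q \<in> polys_over K" using PQ polys_over_mono[OF m(3)] by blast+
      define D where "D = 1 + of_nat p * Q"
      have D: "D \<in> polys_over K" unfolding D_def using RK PQK by (intro subring_intros)
      have "D \<noteq> 0" unfolding D_def by (rule one_plus_mult_nonzero[OF W sep PQ(2)])
      then have D0: "poly D \<tau> \<noteq> 0" using tau_tr[OF D] by blast
      have "x * poly D \<tau> = poly P \<tau>" using PQ(3) by (simp add: D_def)
      then have "x = poly P \<tau> / poly D \<tau>" using D0 by (simp add: field_simps)
      then have "x = poly (pcompose P lin) t / poly (pcompose D lin) t" by (simp add: poly_pcompose lin_t)
      moreover have "pcompose D lin \<noteq> 0" using D0 lin_t by (metis poly_0 poly_pcompose)
      moreover have "pcompose P lin \<in> polys_over K" "pcompose D lin \<in> polys_over K"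
        using K(1) PQK D lin by (auto intro: pcompose_polys_over)
      ultimately show "x \<in> ?L" by blast
    qed
    ultimately show "\<exists>p Z W. padic_model p Z W \<and> S \<subseteq> Z \<and> W \<subseteq> ?L"
      by (intro exI[of _ p] exI[of _ Z'] exI[of _ ?W] conjI)
  qed
qed

section \<open>Models containing a given finite set of complex numbers\<close>

lemma modelled_field_extension:
  assumes good: "modelled_field K"
  shows "\<exists>L. modelled_field L \<and> insert t K \<subseteq> L"
proof -
  have K: "is_subring K" using good by (auto simp: modelled_field_def)
  have const: "[:c:] \<in> polys_over K" if "c \<in> K" for c
    using that K by (auto simp: pCons_polys_over zero_polys_over)
  have X: "[:0, 1:] \<in> polys_over K"
    using K by (auto simp: pCons_polys_over zero_polys_over subring_0 subring_1)
  show ?thesis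
  proof (cases "\<exists>f\<in>polys_over K. f \<noteq> 0 \<and> poly f t = 0")
    case True
    then have "modelled_field ((\<lambda>q. poly q t) ` polys_over K)" using modelled_field_algebraic[OF good] by blast
    moreover have "insert t K \<subseteq> (\<lambda>q. poly q t) ` polys_over K"
    proof
      fix x assume "x \<in> insert t K"
      then show "x \<in> (\<lambda>q. poly q t) ` polys_over K"
        using image_eqI[OF _ X, of t "\<lambda>q. poly q t"] image_eqI[OF _ const, of x "\<lambda>q. poly q t" x] by auto
    qed
    ultimately show ?thesis by blast
  next
    case False
    let ?L = "{poly h t / poly g t | h g. h \<in> polys_over K \<and> g \<in> polys_over K \<and> g \<noteq> 0}"
    have "modelled_field ?L" using False modelled_field_transcendental[OF good] by blast
    moreover have "insert t K \<subseteq> ?L"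
    proof
      fix x assume x: "x \<in> insert t K"
      have "[:1:] \<in> polys_over K" using const subring_1[OF K] by blast
      moreover have "[:1:] \<noteq> (0 :: complex poly)" by simp
      moreover obtain h where "h \<in> polys_over K" "x = poly h t / poly [:1:] t"
      proof (cases "x = t")
        case True
        then show thesis using that[OF X] by simp
      next
        case False
        then show thesis using that[OF const, of x] x by simp
      qed
      ultimately show "x \<in> ?L" by blast
    qed
    ultimately show ?thesis by blast
  qed
qed

lemma padic_model_exists:
  assumes "finite S"
  obtains p Z W where "padic_model p Z W" "S \<subseteq> Z"
proof -
  have "\<exists>K. modelled_field K \<and> S \<subseteq> K"
    using assms
  proof (induction S)
    case empty
    then show ?case using modelled_field_Rats by blast
  next
    case (insert t S)
    then obtain K where "modelled_field K" "S \<subseteq> K" by blast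
    then show ?case using modelled_field_extension[of K t] by blast
  qed
  then obtain K where "modelled_field K" "S \<subseteq> K" by blast
  then have "\<exists>p Z W. padic_model p Z W \<and> S \<subseteq> Z \<and> W \<subseteq> K"
    using assms by (simp add: modelled_field_def)
  then show thesis using that by blast
qed

section \<open>Orbits of invertible matrices\<close>

definition forward_diff :: "(nat \<Rightarrow> 'a::ab_group_add) \<Rightarrow> nat \<Rightarrow> 'a" where
  "forward_diff y n = y (Suc n) - y n"

text \<open>Newton's interpolation formula. The induction runs over all sequences at once, so that
  the formulas for \<open>y\<close> and for its difference can be combined by Pascal's rule.\<close>

lemma newton_forward_diff:
  fixes y :: "nat \<Rightarrow> 'a::comm_ring_1"
  shows "y n = (\<Sum>k\<le>n. of_nat (n choose k) * (forward_diff ^^ k) y 0)"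
proof (induction n arbitrary: y)
  case (Suc n)
  let ?d = "\<lambda>k. (forward_diff ^^ k) y 0"
  have "y (Suc n) = y n + forward_diff y n" by (simp add: forward_diff_def)
  also have "forward_diff y n = (\<Sum>k\<le>n. of_nat (n choose k) * ?d (Suc k))"
    using Suc[of "forward_diff y"] by (simp add: funpow_swap1)
  also have "y n = (\<Sum>k\<le>Suc n. of_nat (n choose k) * ?d k)" using Suc[of y] by (simp add: binomial_eq_0)
  also have "\<dots> = ?d 0 + (\<Sum>k\<le>n. of_nat (n choose Suc k) * ?d (Suc k))"
    by (subst sum.atMost_Suc_shift) simp
  also have "\<dots> + (\<Sum>k\<le>n. of_nat (n choose k) * ?d (Suc k)) =
      ?d 0 + (\<Sum>k\<le>n. of_nat (Suc n choose Suc k) * ?d (Suc k))"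
    by (simp add: sum.distrib algebra_simps)
  also have "\<dots> = (\<Sum>k\<le>Suc n. of_nat (Suc n choose k) * ?d k)"
    by (simp add: sum.atMost_Suc_shift del: sum.atMost_Suc)
  finally show ?case .
qed simp

text \<open>The coefficients \<open>B\<close> do not depend on \<open>n\<close>, so differencing
  commutes with the recurrence and every further difference extracts another factor
  \<open>p\<close>.\<close>

lemma forward_diff_power:
  fixes y :: "'i \<Rightarrow> nat \<Rightarrow> complex"
  assumes W: "is_subring W"
    and y: "\<And>i n. i \<in> I \<Longrightarrow> y i n \<in> W" and B: "\<And>i j. i \<in> I \<Longrightarrow> j \<in> I \<Longrightarrow> B i j \<in> W"
    and rec: "\<And>i n. i \<in> I \<Longrightarrow> forward_diff (y i) n = of_nat p * (\<Sum>j\<in>I. B i j * y j n)"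
    and i: "i \<in> I"
  shows "\<exists>w\<in>W. (forward_diff ^^ k) (y i) n = of_nat p ^ k * w"
proof -
  let ?D = "\<lambda>k i. (forward_diff ^^ k) (y i)"
  have D_Suc: "?D (Suc k) j n = ?D k j (Suc n) - ?D k j n" for k j n
    by (simp add: forward_diff_def)
  have rec': "?D (Suc k) i n = of_nat p * (\<Sum>j\<in>I. B i j * ?D k j n)" if "i \<in> I" for k i n
    using that
  proof (induction k arbitrary: i n)
    case 0
    then show ?case using rec by simp
  next
    case (Suc k)
    have "?D (Suc (Suc k)) i n = ?D (Suc k) i (Suc n) - ?D (Suc k) i n"
      by (rule D_Suc)
    also have "\<dots> = of_nat p * (\<Sum>j\<in>I. B i j * (?D k j (Suc n) - ?D k j n))"
      unfolding Suc.IH[OF Suc.prems] by (simp add: algebra_simps sum_subtractf sum_distrib_left)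
    finally show ?case by (simp only: D_Suc[of k])
  qed
  show ?thesis using i
  proof (induction k arbitrary: i n)
    case 0
    then show ?case using y by auto
  next
    case (Suc k)
    have "\<forall>j\<in>I. \<exists>w. w \<in> W \<and> ?D k j n = of_nat p ^ k * w" using Suc.IH by blast
    then obtain w where w: "\<And>j. j \<in> I \<Longrightarrow> w j \<in> W" "\<And>j. j \<in> I \<Longrightarrow> ?D k j n = of_nat p ^ k * w j"
      by metis
    have "?D (Suc k) i n = of_nat p * (\<Sum>j\<in>I. B i j * (of_nat p ^ k * w j))"
      unfolding rec'[OF Suc.prems] using w(2) by (intro arg_cong2[of _ _ _ _ "(*)"] sum.cong) auto
    also have "\<dots> = of_nat p ^ Suc k * (\<Sum>j\<in>I. B i j * w j)"
      by (simp add: sum_distrib_left mult_ac)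
    finally show ?case
      using W B[OF Suc.prems] w(1) by (intro bexI[of _ "\<Sum>j\<in>I. B i j * w j"]) (auto intro!: subring_intros)
  qed
qed

text \<open>The step matrix is congruent to 1 modulo \<open>p\<close>, so the \<open>k\<close>-th
  differences at 0 are divisible by \<open>p ^ k\<close>; this gives the Newton series to which
  \<open>newton_series_zero\<close> applies.\<close>

lemma linear_recurrence_zeros:
  fixes y :: "'i \<Rightarrow> nat \<Rightarrow> complex"
  assumes W: "is_subring W" "separated p W" and p: "prime p" "p > 2"
    and y: "\<And>i n. i \<in> I \<Longrightarrow> y i n \<in> W" and B: "\<And>i j. i \<in> I \<Longrightarrow> j \<in> I \<Longrightarrow> B i j \<in> W"
    and rec: "\<And>i n. i \<in> I \<Longrightarrow> y i (Suc n) = y i n + of_nat p * (\<Sum>j\<in>I. B i j * y j n)"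
    and i: "i \<in> I" and inf: "infinite {n. y i n = 0}"
  shows "y i n = 0"
proof -
  have "\<exists>w\<in>W. (forward_diff ^^ k) (y i) 0 = of_nat p ^ k * w" for k
    by (rule forward_diff_power[where y = y and B = B, OF W(1) y B _ i]) (auto simp: forward_diff_def rec)
  then obtain b where b: "\<And>k. b k \<in> W" "\<And>k. (forward_diff ^^ k) (y i) 0 = of_nat p ^ k * b k"
    by metis
  have newton: "y i n = (\<Sum>k\<le>n. of_nat (n choose k) * (of_nat p ^ k * b k))" for n
    using newton_forward_diff[of "y i" n] by (simp add: b(2))
  show ?thesis
    unfolding newton
    by (rule newton_series_zero[OF W p b(1)]) (use inf in \<open>simp flip: newton\<close>)
qed

section \<open>Powers of matrices and the zeros of their orbits\<close>

lemma pow_mat_add: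
  assumes "A \<in> carrier_mat d d"
  shows "A ^\<^sub>m (k + l) = A ^\<^sub>m k * A ^\<^sub>m l"
proof (induction l)
  case (Suc l)
  then show ?case using assms
    by (simp add: assoc_mult_mat[of "A ^\<^sub>m k" d d "A ^\<^sub>m l" d A d] pow_carrier_mat)
qed (use assms in auto)

lemma pow_mat_inverse:
  assumes A: "A \<in> carrier_mat d d" and B: "B \<in> carrier_mat d d" and AB: "A * B = 1\<^sub>m d"
  shows "A ^\<^sub>m k * B ^\<^sub>m k = 1\<^sub>m d"
proof (induction k)
  case (Suc k)
  have Ak: "A ^\<^sub>m k \<in> carrier_mat d d" and Bk: "B ^\<^sub>m k \<in> carrier_mat d d"
    using A B by (auto intro: pow_carrier_mat)
  have "B ^\<^sub>m Suc k = B * B ^\<^sub>m k" using pow_mat_add[OF B, of 1 k] B by simp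
  then have "A ^\<^sub>m Suc k * B ^\<^sub>m Suc k = A ^\<^sub>m k * (A * (B * B ^\<^sub>m k))"
    using A B Ak Bk by (simp add: assoc_mult_mat[of _ d d _ d _ d])
  also have "A * (B * B ^\<^sub>m k) = B ^\<^sub>m k"
    using A B Bk AB by (simp flip: assoc_mult_mat[of _ d d _ d _ d])
  finally show ?case using Suc by simp
qed (use A B in auto)

lemma mult_mat_entry:
  assumes "A \<in> carrier_mat d d" "B \<in> carrier_mat d d" "i < d" "j < d"
  shows "(A * B) $$ (i, j) = (\<Sum>k<d. A $$ (i, k) * B $$ (k, j))"
  using assms by (simp add: scalar_prod_def atLeast0LessThan)

lemma mult_mat_vec_entry:
  assumes "A \<in> carrier_mat d d" "v \<in> carrier_vec d" "i < d"
  shows "(A *\<^sub>v v) $ i = (\<Sum>k<d. A $$ (i, k) * v $ k)"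
  using assms by (simp add: scalar_prod_def atLeast0LessThan)

lemma pow_mat_entry_in_subring:
  assumes W: "is_subring W" and A: "A \<in> carrier_mat d d"
    and AW: "\<And>i j. i < d \<Longrightarrow> j < d \<Longrightarrow> A $$ (i, j) \<in> W"
  shows "i < d \<Longrightarrow> j < d \<Longrightarrow> (A ^\<^sub>m k) $$ (i, j) \<in> W"
proof (induction k arbitrary: i j)
  case 0
  then show ?case using A W by (auto intro: subring_intros)
next
  case (Suc k)
  have "(A ^\<^sub>m Suc k) $$ (i, j) = (\<Sum>l<d. (A ^\<^sub>m k) $$ (i, l) * A $$ (l, j))"
    using mult_mat_entry[OF pow_carrier_mat[OF A] A Suc.prems] by simp
  then show ?case using Suc AW W by (auto intro!: subring_intros)
qed

text \<open>Finitely many residues for finitely many entries leave two powers \<open>a < b\<close>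
  of \<open>A\<close> congruent modulo \<open>p\<close>, and multiplying by
  \<open>B ^\<^sub>m a\<close> cancels the lower one. Residues of \<open>Z\<close> are taken modulo
  \<open>p W\<close>, which is why \<open>C\<close> has entries in \<open>W\<close>.\<close>

lemma pow_mat_congruent_one:
  assumes model: "padic_model p Z W"
    and A: "A \<in> carrier_mat d d" and B: "B \<in> carrier_mat d d" and AB: "A * B = 1\<^sub>m d"
    and AZ: "\<And>i j. i < d \<Longrightarrow> j < d \<Longrightarrow> A $$ (i, j) \<in> Z"
    and BZ: "\<And>i j. i < d \<Longrightarrow> j < d \<Longrightarrow> B $$ (i, j) \<in> Z"
  shows "\<exists>m>0. \<exists>C. \<forall>i<d. \<forall>j<d. C i j \<in> W \<and>
    (A ^\<^sub>m m) $$ (i, j) = (1\<^sub>m d) $$ (i, j) + of_nat p * C i j"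
proof -
  have Z: "is_subring Z" and W: "is_subring W" and ZW: "Z \<subseteq> W"
    using model by (auto simp: padic_model_def)
  obtain F where F: "finite F" "\<forall>z\<in>Z. \<exists>f\<in>F. \<exists>w\<in>W. z = f + of_nat p * w"
    using model by (auto simp: padic_model_def)
  then obtain res where res: "\<And>z. z \<in> Z \<Longrightarrow> res z \<in> F" "\<And>z. z \<in> Z \<Longrightarrow> \<exists>w\<in>W. z = res z + of_nat p * w"
    by metis
  define I where "I = {..<d} \<times> {..<d}"
  \<comment> \<open>The restriction to \<open>I\<close> places all codes in one finite space of
    extensional functions.\<close>
  define code where "code = (\<lambda>k. restrict (\<lambda>ij. res ((A ^\<^sub>m k) $$ ij)) I)"
  have pow_Z: "(A ^\<^sub>m k) $$ (i, j) \<in> Z" "(B ^\<^sub>m k) $$ (i, j) \<in> Z" if "i < d" "j < d" for i j k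
    using pow_mat_entry_in_subring[OF Z A AZ that] pow_mat_entry_in_subring[OF Z B BZ that] by auto
  have "code k \<in> PiE I (\<lambda>_. F)" for k
    unfolding code_def using pow_Z res(1) by (auto simp only: restrict_PiE_iff I_def mem_Sigma_iff lessThan_iff)
  then have "range code \<subseteq> PiE I (\<lambda>_. F)" by blast
  moreover have "finite (PiE I (\<lambda>_. F))" using F(1) by (intro finite_PiE) (auto simp: I_def)
  ultimately have "\<not> inj code" using finite_subset finite_imageD infinite_UNIV_nat by blast
  then obtain a b where ab: "a < b" "code a = code b"
    unfolding inj_def by (metis linorder_neqE_nat)
  have "\<exists>c\<in>W. (A ^\<^sub>m b) $$ (i, j) = (A ^\<^sub>m a) $$ (i, j) + of_nat p * c" if ij: "i < d" "j < d" for i j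
  proof -
    have "res ((A ^\<^sub>m a) $$ (i, j)) = res ((A ^\<^sub>m b) $$ (i, j))"
      using fun_cong[OF ab(2), of "(i, j)"] ij by (simp add: code_def I_def)
    then obtain u v where "u \<in> W" "v \<in> W"
      "(A ^\<^sub>m a) $$ (i, j) = res ((A ^\<^sub>m b) $$ (i, j)) + of_nat p * u"
      "(A ^\<^sub>m b) $$ (i, j) = res ((A ^\<^sub>m b) $$ (i, j)) + of_nat p * v"
      using res(2)[OF pow_Z(1)[OF ij, of a]] res(2)[OF pow_Z(1)[OF ij, of b]] by metis
    moreover from this have "(A ^\<^sub>m b) $$ (i, j) = (A ^\<^sub>m a) $$ (i, j) + of_nat p * (v - u)"
      by (simp add: algebra_simps)
    ultimately show ?thesis using subring_diff[OF W] by blast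
  qed
  then obtain c where c: "\<And>i j. i < d \<Longrightarrow> j < d \<Longrightarrow> c i j \<in> W"
    "\<And>i j. i < d \<Longrightarrow> j < d \<Longrightarrow> (A ^\<^sub>m b) $$ (i, j) = (A ^\<^sub>m a) $$ (i, j) + of_nat p * c i j"
    by metis
  define C where "C = (\<lambda>i j. \<Sum>k<d. c i k * (B ^\<^sub>m a) $$ (k, j))"
  have pA: "A ^\<^sub>m k \<in> carrier_mat d d" and pB: "B ^\<^sub>m k \<in> carrier_mat d d" for k
    using A B by (auto intro: pow_carrier_mat)
  have "A ^\<^sub>m (b - a) = A ^\<^sub>m (b - a) * (A ^\<^sub>m a * B ^\<^sub>m a)"
    by (simp only: pow_mat_inverse[OF A B AB] right_mult_one_mat[OF pA])
  also have "\<dots> = A ^\<^sub>m b * B ^\<^sub>m a"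
    using ab(1) pow_mat_add[OF A, of "b - a" a] pA pB
    by (simp flip: assoc_mult_mat[of _ d d _ d _ d])
  finally have Am: "A ^\<^sub>m (b - a) = A ^\<^sub>m b * B ^\<^sub>m a" .
  have "C i j \<in> W \<and> (A ^\<^sub>m (b - a)) $$ (i, j) = (1\<^sub>m d) $$ (i, j) + of_nat p * C i j"
    if ij: "i < d" "j < d" for i j
  proof
    show "C i j \<in> W"
      unfolding C_def using ij c(1) pow_Z ZW W by (auto intro!: subring_sum subring_mult)
    have "(A ^\<^sub>m (b - a)) $$ (i, j) =
        (\<Sum>k<d. ((A ^\<^sub>m a) $$ (i, k) + of_nat p * c i k) * (B ^\<^sub>m a) $$ (k, j))"
      unfolding Am mult_mat_entry[OF pA pB ij] using ij by (intro sum.cong) (auto simp: c(2))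
    also have "\<dots> = (\<Sum>k<d. (A ^\<^sub>m a) $$ (i, k) * (B ^\<^sub>m a) $$ (k, j)) + of_nat p * C i j"
      by (simp add: C_def algebra_simps sum.distrib sum_distrib_left)
    also have "(\<Sum>k<d. (A ^\<^sub>m a) $$ (i, k) * (B ^\<^sub>m a) $$ (k, j)) = (1\<^sub>m d) $$ (i, j)"
      unfolding mult_mat_entry[OF pA pB ij, symmetric] pow_mat_inverse[OF A B AB] ..
    finally show "(A ^\<^sub>m (b - a)) $$ (i, j) = (1\<^sub>m d) $$ (i, j) + of_nat p * C i j" .
  qed
  then show ?thesis using ab(1) by (intro exI[of _ "b - a"]) auto
qed

text \<open>Along the progression \<open>r + m * n\<close> the orbit advances by
  \<open>A ^\<^sub>m m\<close>, which is congruent to 1 modulo \<open>p\<close>, so all entries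
  together satisfy the recurrence of \<open>linear_recurrence_zeros\<close>. One \<open>m\<close>
  serves every start \<open>r\<close> and every entry \<open>i\<close>, which gives the common zeros
  of several entries a common period.\<close>

theorem skolem_mahler_lech_orbit:
  fixes A B :: "complex mat"
  assumes A: "A \<in> carrier_mat d d" and B: "B \<in> carrier_mat d d" and AB: "A * B = 1\<^sub>m d"
    and v: "v \<in> carrier_vec d"
  shows "\<exists>m>0. \<forall>r. \<forall>i<d. infinite {n. (A ^\<^sub>m (r + m * n) *\<^sub>v v) $ i = 0} \<longrightarrow>
    (\<forall>n. (A ^\<^sub>m (r + m * n) *\<^sub>v v) $ i = 0)"
proof -
  define S where "S = (\<lambda>ij. A $$ ij) ` ({..<d} \<times> {..<d}) \<union> (\<lambda>ij. B $$ ij) ` ({..<d} \<times> {..<d}) \<union> (\<lambda>i. v $ i) ` {..<d}"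
  have "finite S" by (simp add: S_def)
  then obtain p Z W where model: "padic_model p Z W" and SZ: "S \<subseteq> Z" using padic_model_exists by blast
  have Z: "is_subring Z" and W: "is_subring W" "separated p W" and ZW: "Z \<subseteq> W" and p: "prime p" "p > 2"
    using model by (auto simp: padic_model_def)
  have AZ: "A $$ (i, j) \<in> Z" and BZ: "B $$ (i, j) \<in> Z" if "i < d" "j < d" for i j
    using SZ that unfolding S_def by auto
  have vZ: "v $ i \<in> Z" if "i < d" for i using SZ that unfolding S_def by auto
  obtain m C where m: "m > 0" and C: "\<forall>i<d. \<forall>j<d. C i j \<in> W \<and>
      (A ^\<^sub>m m) $$ (i, j) = (1\<^sub>m d) $$ (i, j) + of_nat p * C i j"
    using pow_mat_congruent_one[OF model A B AB AZ BZ] by blast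
  have pA: "A ^\<^sub>m k \<in> carrier_mat d d" for k using A by (rule pow_carrier_mat)
  have "(A ^\<^sub>m (r + m * n) *\<^sub>v v) $ i = 0"
    if i: "i < d" and inf: "infinite {n. (A ^\<^sub>m (r + m * n) *\<^sub>v v) $ i = 0}" for r i n
  proof -
    define y where "y = (\<lambda>i n. (A ^\<^sub>m (r + m * n) *\<^sub>v v) $ i)"
    have "y i n = 0"
    proof (rule linear_recurrence_zeros[OF W p, of "{..<d}" y C])
      show "y i n \<in> W" if "i \<in> {..<d}" for i n
        unfolding y_def using that pow_mat_entry_in_subring[OF Z A AZ] vZ ZW W(1)
        by (subst mult_mat_vec_entry[OF pA v]) (auto intro!: subring_sum subring_mult)
      show "C i j \<in> W" if "i \<in> {..<d}" "j \<in> {..<d}" for i j using C that by auto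
      show "y i (Suc n) = y i n + of_nat p * (\<Sum>j\<in>{..<d}. C i j * y j n)" if "i \<in> {..<d}" for i n
      proof -
        define x where "x = A ^\<^sub>m (r + m * n) *\<^sub>v v"
        have x: "x \<in> carrier_vec d" unfolding x_def using pA v by (rule mult_mat_vec_carrier)
        have "A ^\<^sub>m (r + m * Suc n) = A ^\<^sub>m m * A ^\<^sub>m (r + m * n)"
          using pow_mat_add[OF A, of m "r + m * n"] by (simp add: add.left_commute)
        then have "A ^\<^sub>m (r + m * Suc n) *\<^sub>v v = A ^\<^sub>m m *\<^sub>v x"
          unfolding x_def by (simp only: assoc_mult_mat_vec[OF pA pA v])
        then have "y i (Suc n) = (\<Sum>j<d. (A ^\<^sub>m m) $$ (i, j) * x $ j)"
          unfolding y_def using that by (simp add: mult_mat_vec_entry[OF pA x])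
        also have "\<dots> = (\<Sum>j<d. (if i = j then x $ j else 0) + of_nat p * (C i j * x $ j))"
          using that C by (intro sum.cong) (auto simp: algebra_simps)
        also have "\<dots> = x $ i + of_nat p * (\<Sum>j<d. C i j * x $ j)"
          using that by (simp add: sum.distrib sum_distrib_left)
        finally show ?thesis by (simp add: y_def x_def)
      qed
    qed (use i inf in \<open>auto simp: y_def\<close>)
    then show ?thesis by (simp add: y_def)
  qed
  then show ?thesis using m by blast
qed

section \<open>From eventually periodic zero sets to a finite automaton\<close>

lemma eventually_periodic_common_zeros:
  fixes x :: "'i \<Rightarrow> nat \<Rightarrow> 'a::zero"
  assumes m: "m > 0"
    and sml: "\<And>r i. i \<in> I \<Longrightarrow> infinite {n. x i (r + m * n) = 0} \<Longrightarrow> (\<forall>n. x i (r + m * n) = 0)"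
  shows "\<exists>N. \<forall>k\<ge>N. (\<forall>i\<in>I. x i k = 0) \<longleftrightarrow> (\<forall>i\<in>I. x i (k + m) = 0)"
proof -
  define L where "L = {k. \<forall>i\<in>I. x i k = 0}"
  define T where "T = (\<lambda>r. {n. r + m * n \<in> L})"
  \<comment> \<open>The finitely many common zeros in progressions that meet \<open>L\<close> only
    finitely often. Beyond them, membership in \<open>L\<close> depends on the residue modulo
    \<open>m\<close> alone.\<close>
  define E where "E = (\<Union>r\<in>{r. r < m \<and> finite (T r)}. (\<lambda>n. r + m * n) ` T r)"
  have full: "r + m * n \<in> L" if "infinite (T r)" for r n
  proof -
    have "infinite {n. x i (r + m * n) = 0}" if "i \<in> I" for i
      by (rule infinite_super[OF _ \<open>infinite (T r)\<close>]) (use that in \<open>auto simp: T_def L_def\<close>)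
    then show ?thesis using sml unfolding L_def by blast
  qed
  have "finite E" unfolding E_def by auto
  then obtain N where N: "\<forall>k\<in>E. k < N" by (metis finite_nat_set_iff_bounded)
  have char: "k \<in> L \<longleftrightarrow> infinite (T (k mod m))" if "k \<ge> N" for k
  proof
    assume "k \<in> L"
    show "infinite (T (k mod m))"
    proof
      assume "finite (T (k mod m))"
      moreover have "k = k mod m + m * (k div m)" by simp
      ultimately have "k \<in> E" using \<open>k \<in> L\<close> m unfolding E_def T_def
        by (intro UN_I[of "k mod m"] image_eqI[of _ _ "k div m"]) auto
      then show False using N that by auto
    qed
  next
    assume "infinite (T (k mod m))"
    then show "k \<in> L" using full[of "k mod m" "k div m"] by simp
  qed
  have "k \<in> L \<longleftrightarrow> k + m \<in> L" if "k \<ge> N" for k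
    using char[of k] char[of "k + m"] that by simp
  then show ?thesis unfolding L_def by blast
qed

text \<open>A lasso: a tail of \<open>N\<close> states followed by a cycle of \<open>m\<close>
  states, the last state \<open>N + m - 1\<close> leading back to \<open>N\<close>.\<close>

lemma dfa_of_eventually_periodic:
  fixes a :: 'a
  assumes m: "m > 0" and per: "\<And>k. k \<ge> N \<Longrightarrow> Q k \<longleftrightarrow> Q (k + m)"
  shows "\<exists>D :: (nat, 'a) dfa. is_dfa {a} D \<and> (\<forall>k. dfa_accepts D (replicate k a) \<longleftrightarrow> Q k)"
proof -
  define next_state where "next_state = (\<lambda>q. if Suc q < N + m then Suc q else N)"
  define D :: "(nat, 'a) dfa" where
    "D = \<lparr>dstates = {..<N + m}, dtrans = (\<lambda>q _. next_state q), dinit = 0, dfinal = {q. q < N + m \<and> Q q}\<rparr>"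
  define reach where "reach = (\<lambda>k. fold (\<lambda>\<sigma> q. dtrans D q \<sigma>) (replicate k a) (dinit D))"
  have reach_simps: "reach 0 = 0" "reach (Suc k) = next_state (reach k)" for k
    unfolding reach_def
    by (simp_all add: D_def flip: replicate_append_same del: replicate.simps(2))
  \<comment> \<open>\<open>i\<close> counts the completed rounds of the cycle.\<close>
  have inv: "\<exists>i. k = reach k + i * m \<and> reach k < N + m \<and> (i = 0 \<or> reach k \<ge> N)" for k
  proof (induction k)
    case 0
    then show ?case using m by (auto simp: reach_simps)
  next
    case (Suc k)
    then obtain i where i: "k = reach k + i * m" "reach k < N + m" "i = 0 \<or> reach k \<ge> N" by blast
    show ?case
    proof (cases "Suc (reach k) < N + m")
      case True
      then show ?thesis using i by (intro exI[of _ i]) (auto simp: reach_simps next_state_def)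
    next
      case False
      then have "Suc (reach k) = N + m" using i(2) by simp
      then show ?thesis using i m False by (intro exI[of _ "Suc i"]) (auto simp: reach_simps next_state_def)
    qed
  qed
  have shift: "Q (q + i * m) \<longleftrightarrow> Q q" if "q \<ge> N" for q i
  proof (induction i)
    case (Suc i)
    then show ?case using per[of "q + i * m"] that by (simp add: algebra_simps)
  qed simp
  have "is_dfa {a} D" using m by (auto simp: is_dfa_def D_def next_state_def)
  moreover have "dfa_accepts D (replicate k a) \<longleftrightarrow> Q k" for k
  proof -
    obtain i where i: "k = reach k + i * m" "reach k < N + m" "i = 0 \<or> reach k \<ge> N" using inv by blast
    then have "Q k \<longleftrightarrow> Q (reach k)" using shift[of "reach k" i] by auto
    moreover have "dfa_accepts D (replicate k a) \<longleftrightarrow> reach k \<in> dfinal D"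
      by (simp add: dfa_accepts_def reach_def)
    ultimately show ?thesis using i(2) by (simp add: D_def)
  qed
  ultimately show ?thesis by blast
qed

lemma final_vec_replicate:
  assumes U: "qtrans M a \<in> carrier_mat d d" and v: "qinit M \<in> carrier_vec d"
  shows "final_vec M (replicate k a) = qtrans M a ^\<^sub>m k *\<^sub>v qinit M"
proof (induction k)
  case 0
  then show ?case using U v by (simp add: final_vec_def)
next
  case (Suc k)
  \<comment> \<open>The last letter is split off, because \<open>fold\<close> applies the first
    letter first.\<close>
  have "final_vec M (replicate (Suc k) a) = qtrans M a *\<^sub>v final_vec M (replicate k a)"
    unfolding final_vec_def replicate_append_same[symmetric] replicate_Suc by simp
  also have "\<dots> = qtrans M a ^\<^sub>m (1 + k) *\<^sub>v qinit M"
    unfolding Suc pow_mat_add[OF U] using U v by (simp add: assoc_mult_mat_vec[OF U pow_carrier_mat[OF U] v])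
  finally show ?case by simp
qed

theorem theorem2:
  fixes a :: 'a and P :: "'a promise"
  assumes "promise_problem {a} P"
    and "\<exists>(M :: 'a lv_qfa) (p :: real). las_vegas_qfa {a} M \<and> p > 0 \<and> lv_solves M P p"
  shows "\<exists>D :: (nat, 'a) dfa. is_dfa {a} D \<and> dfa_solves D P"
proof -
  obtain M :: "'a lv_qfa" and p :: real where
    M: "las_vegas_qfa {a} M" and p: "p > 0" and solves: "lv_solves M P p"
    using assms(2) by blast
  define d where "d = qstates M"
  define U where "U = qtrans M a"
  have "mc_qfa {a} M" using M by (simp add: las_vegas_qfa_def)
  then have "unitary_mat d U" and v: "qinit M \<in> carrier_vec d"
    by (simp_all add: mc_qfa_def d_def U_def)
  then have U: "U \<in> carrier_mat d d" and inv: "U * mat_adjoint U = 1\<^sub>m d"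
    by (simp_all add: unitary_mat_def)
  have adj: "mat_adjoint U \<in> carrier_mat d d"
    unfolding mat_adjoint_def using mat_of_rows_carrier(1)[of "dim_row U" "map conjugate (cols U)"] U by simp
  have rej: "rejecting M \<subseteq> {..<d}" using M by (auto simp: las_vegas_qfa_def d_def)
  define x where "x = (\<lambda>j k. (U ^\<^sub>m k *\<^sub>v qinit M) $ j)"
  \<comment> \<open>\<open>Q k\<close> says that the word of length \<open>k\<close> is rejected
    with probability 0. Yes-instances satisfy it, while no-instances violate it because they are
    rejected with probability at least \<open>p > 0\<close>.\<close>
  define Q where "Q = (\<lambda>k. \<forall>j\<in>rejecting M. x j k = 0)"
  have prob: "prob_in M (rejecting M) (replicate k a) = 0 \<longleftrightarrow> Q k" for k
    unfolding prob_in_def Q_def x_def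
    using final_vec_replicate[of M a d k] U v finite_subset[OF rej]
    by (subst sum_nonneg_eq_0_iff) (auto simp: U_def)
  \<comment> \<open>Unitarity supplies the adjoint as the inverse matrix that the orbit theorem asks
    for.\<close>
  obtain m where m: "m > 0" and sml: "\<forall>r. \<forall>j<d. infinite {n. x j (r + m * n) = 0} \<longrightarrow> (\<forall>n. x j (r + m * n) = 0)"
    using skolem_mahler_lech_orbit[OF U adj inv v] unfolding x_def by blast
  have "\<exists>N. \<forall>k\<ge>N. Q k \<longleftrightarrow> Q (k + m)"
    unfolding Q_def by (rule eventually_periodic_common_zeros[OF m]) (use sml rej in auto)
  then obtain N where N: "\<And>k. k \<ge> N \<Longrightarrow> Q k \<longleftrightarrow> Q (k + m)" by blast
  obtain D :: "(nat, 'a) dfa" where "is_dfa {a} D \<and> (\<forall>k. dfa_accepts D (replicate k a) \<longleftrightarrow> Q k)"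
    using dfa_of_eventually_periodic[where Q = Q and N = N and a = a, OF m N] ..
  then have D: "is_dfa {a} D" "\<And>k. dfa_accepts D (replicate k a) \<longleftrightarrow> Q k" by simp_all
  have unary: "w = replicate (length w) a" if "w \<in> fst P \<union> snd P" for w
    using that assms(1) unfolding promise_problem_def by (intro replicate_eqI) (auto simp: in_lists_conv_set)
  have accepts: "dfa_accepts D w \<longleftrightarrow> prob_in M (rejecting M) w = 0" if "w \<in> fst P \<union> snd P" for w
    using D(2)[of "length w"] prob[of "length w"] by (simp only: unary[OF that, symmetric])
  have "dfa_solves D P"
    unfolding dfa_solves_def using accepts solves p by (auto simp: lv_solves_def)
  then show ?thesis using D(1) by blast
qed

end
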